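(* Let $\mathcal U=(U,A_L,s_L,t_L,\Delta_L,\epsilon_L,S)$ and $\mathcal U'=(U',A_L',s'_L,t'_L,\Delta'_L,\epsilon'_L,S')$ be Hopf algebroids over $k$. Let $P$ and $P'$ be SAYD modules over $\mathcal U$ and $\mathcal U'$ respectively. Let $C$ be a cocommutative $k$-coalgebra, let $(\Psi,\psi):C\longrightarrow V(\mathcal U,\mathcal U')$ be a measuring of Hopf algebroids and let $\Omega:D\longrightarrow Vect_k(P,P')$ be a $(C,\Psi,\psi)$-comodule measuring from $P$ to $P'$. Then, for each $y\in D$ (and each $n$), $$\overline\Omega^n(y)\circ\xi_n(\mathcal U;P)=\xi_n(\mathcal U';P')\circ\underline\Omega_n(y):C_n(\mathcal U;P)\longrightarrow C^n(\mathcal U';P').$$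
   Context: $k$ is a field; $Vect_k(V,W)$ denotes the space of $k$-linear maps. Sweedler notation is used with summation suppressed; a right $C$-coaction is written $y\mapsto y_{(0)}\otimes y_{(1)}$, iterated $y_{(0)}\otimes y_{(1)}\otimes\dots\otimes y_{(n)}$. Left bialgebroid $(U,A_L,s_L,t_L,\Delta_L,\epsilon_L)$ over $k$ (write $A=A_L$): unital $k$-algebras $U,A$; $k$-algebra morphisms $s_L:A\to U$, $t_L:A^{op}\to U$ with commuting images; $U$ is an $(A,A)$-bimodule via $a\cdot u\cdot b=s_L(a)t_L(b)u$ and $U\otimes_{A_L}U$ is formed with this structure (so $t_L(a)u\otimes v=u\otimes s_L(a)v$); $(U,\Delta_L:U\to U\otimes_{A_L}U,\epsilon_L:U\to A_L)$ is a coalgebra in $(A,A)$-bimodules such that $\Delta_L$ takes values in $U\times_{A_L}U:=\{\sum u_i\otimes u_i' : \sum u_it_L(a)\otimes u'_i=\sum u_i\otimes u_i's_L(a)\ \forall a\in A\}$ (an algebra under factorwise multiplication), $\Delta_L:U\to U\times_{A_L}U$ is a unital algebra morphism, and $\epsilon_L(us_L(\epsilon_L(u')))=\epsilon_L(uu')=\epsilon_L(ut_L(\epsilon_L(u')))$. Hopf algebroid $\mathcal U=(U,A_L,s_L,t_L,\Delta_L,\epsilon_L,S)$: a left bialgebroid with an involutive ($S^2=\mathrm{id}$) anti-automorphism $S$ of the $k$-algebra $U$ with $S\circ t_L=s_L$ and, in $U\otimes_{A_L}U$ for all $u\in U$, $S(u_{(1)})_{(1)}u_{(2)}\otimes S(u_{(1)})_{(2)}=1_U\otimes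 S(u)$ and $S(u_{(2)})_{(1)}\otimes S(u_{(2)})_{(2)}u_{(1)}=S(u)\otimes 1_U$. Notation: $a\triangleright u\triangleleft b=s_L(a)t_L(b)u$, $a\blacktriangleright u\blacktriangleleft b=us_L(b)t_L(a)$. ${}_\blacktriangleright U\otimes_{A^{op}}U_\triangleleft$ is $U\otimes_kU$ modulo the relations $ut_L(a)\otimes v=u\otimes t_L(a)v$. The map $\beta(\mathcal U):{}_\blacktriangleright U\otimes_{A^{op}}U_\triangleleft\to U_\triangleleft\otimes_A{}_\triangleright U$, $u\otimes v\mapsto u_{(1)}\otimes u_{(2)}v$ is bijective for a Hopf algebroid, and one writes $u_+\otimes u_-:=\beta(\mathcal U)^{-1}(u\otimes_A1)$. SAYD module $P$ over $\mathcal U$: (1) a right $U$-module; (2) a left comodule over the $A$-coring $U$: a left $A$-module $(a,p)\mapsto ap$ with a left $A$-linear, coassociative and counital coaction $\Delta_P:P\to U_\triangleleft\otimes_AP$, $p\mapsto p_{(-1)}\otimes p_{(0)}$ (tensor relation $t_L(a)u\otimes p=u\otimes ap$); (3) $ps_L(a)t_L(b)=b\,\epsilon_L(p_{(-1)}s_L(a))p_{(0)}$ for $a,b\in A$; (4) $\Delta_P(pu)=u_-p_{(-1)}u_{+(1)}\otimes_Ap_{(0)}u_{+(2)}$; and (stability) $p_{(0)}p_{(-1)}=p$. Measuring of algebras: for $k$-algebras $R,R'$ and a $k$-coalgebra $C$ with counit $\epsilon_C$, a linear map $\psi:C\to Vect_k(R,R')$ with $\psi(x)(ab)=\psi(x_{(1)})(a)\psi(x_{(2)})(b)$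 and $\psi(x)(1_R)=\epsilon_C(x)1_{R'}$. Measuring of Hopf algebroids from $\mathcal U$ to $\mathcal U'$ by a cocommutative $k$-coalgebra $C$: a pair of algebra measurings $\Psi:C\to Vect_k(U,U')$, $\psi:C\to Vect_k(A_L,A'_L)$ such that for all $x\in C$: $\Psi(x)s_L=s_L'\psi(x)$, $\Psi(x)t_L=t'_L\psi(x)$, $\Psi(x)S=S'\Psi(x)$, $\psi(x)\epsilon_L=\epsilon_L'\Psi(x)$, and $\Delta'_L(\Psi(x)(u))=\Psi(x_{(1)})(u_{(1)})\otimes\Psi(x_{(2)})(u_{(2)})$ in $U'\otimes_{A'_L}U'$ for all $u\in U$. The map $(\Psi,\psi)$ takes values in $V(\mathcal U,\mathcal U'):=\{(F,f)\in Vect_k(U,U')\times Vect_k(A_L,A_L'): Fs_L=s_L'f,\ Ft_L=t_L'f,\ FS=S'F,\ f\epsilon_L=\epsilon_L'F\}$. $(C,\Psi,\psi)$-comodule measuring from $P$ to $P'$: a right $C$-comodule $D$ and a linear map $\Omega:D\to Vect_k(P,P')$ such that for all $y\in D$, $p\in P$, $u\in U$: $\Omega(y)(pu)=\Omega(y_{(0)})(p)\,\Psi(y_{(1)})(u)$, and $\Delta'_{P'}(\Omega(y)(p))=\Psi(y_{(1)})(p_{(-1)})\otimes_{A'}\Omega(y_{(0)})(p_{(0)})$. One writes $x(u)=\Psi(x)(u)$, $y(p)=\Omega(y)(p)$. $C_n(\mathcal U;P)=P\otimes_{A^{op}}({}_\blacktriangleright U_\triangleleft)^{\otimes_{A^{op}}n}$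 (relations $pt_L(a)\otimes u=p\otimes t_L(a)u$, $ut_L(a)\otimes v=u\otimes t_L(a)v$) and $C^n(\mathcal U;P)=({}_\triangleright U_\triangleleft)^{\otimes_An}\otimes_AP$ (relations $t_L(a)u\otimes v=u\otimes s_L(a)v$, $t_L(a)u\otimes p=u\otimes ap$). The induced maps are $$\underline\Omega_n(y)(p\otimes u^1\otimes\dots\otimes u^n)=y_{(0)}(p)\otimes y_{(1)}(u^1)\otimes\dots\otimes y_{(n)}(u^n),\quad\overline\Omega^n(y)(u^1\otimes\dots\otimes u^n\otimes p)=y_{(1)}(u^1)\otimes\dots\otimes y_{(n)}(u^n)\otimes y_{(0)}(p).$$ The Hopf-Galois isomorphism $\xi_n(\mathcal U;P):C_n(\mathcal U;P)\to C^n(\mathcal U;P)$ is $$p\otimes u^1\otimes\dots\otimes u^n\mapsto u^1_{(1)}\otimes u^1_{(2)}u^2_{(1)}\otimes\dots\otimes u^1_{(n)}u^2_{(n-1)}\cdots u^{n-1}_{(2)}u^n\otimes p.$$ *)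

theory Defs
  imports Complex_Main "HOL-Library.Poly_Mapping"
begin

section \<open>Tensor products by generators and relations\<close>

text \<open>
  The free \<open>k\<close>-vector space on a set of generators of type \<open>'x\<close> is modelled by finitely
  supported functions \<open>'x \<Rightarrow>\<^sub>0 'k\<close>.  A presentation \<open>(X, R)\<close> denotes the quotient
  of the free vector space on \<open>X\<close> by the subspace spanned by \<open>R\<close>; its elements are the
  cosets, i.e. equivalence classes.
\<close>

definition fscale :: "'k::field \<Rightarrow> ('x \<Rightarrow>\<^sub>0 'k) \<Rightarrow> ('x \<Rightarrow>\<^sub>0 'k)" where
  "fscale c r = Poly_Mapping.map ((*) c) r"

lemma lookup_fscale: "Poly_Mapping.lookup (fscale c r) x = c * Poly_Mapping.lookup r x"
  by (simp add: fscale_def Poly_Mapping.map.rep_eq when_def)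

global_interpretation fvs: vector_space "fscale :: 'k::field \<Rightarrow> ('x \<Rightarrow>\<^sub>0 'k) \<Rightarrow> ('x \<Rightarrow>\<^sub>0 'k)"
  by unfold_locales
    (auto intro!: poly_mapping_eqI simp: lookup_fscale lookup_add algebra_simps)

abbreviation gen :: "'x \<Rightarrow> ('x \<Rightarrow>\<^sub>0 'k::field)" where
  "gen x \<equiv> Poly_Mapping.single x 1"

text \<open>\<open>lext sc f\<close> is the linear extension of \<open>f\<close> from generators to formal sums, with values in
  a vector space with scalar multiplication \<open>sc\<close>.\<close>

definition lext :: "('k::field \<Rightarrow> 'v \<Rightarrow> 'v) \<Rightarrow> ('x \<Rightarrow> 'v::ab_group_add) \<Rightarrow> ('x \<Rightarrow>\<^sub>0 'k) \<Rightarrow> 'v" where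
  "lext sc f r = (\<Sum>x\<in>Poly_Mapping.keys r. sc (Poly_Mapping.lookup r x) (f x))"

type_synonym ('x, 'k) presentation = "'x set \<times> ('x \<Rightarrow>\<^sub>0 'k) set"

definition tens_rel :: "('x, 'k::field) presentation \<Rightarrow> (('x \<Rightarrow>\<^sub>0 'k) \<times> ('x \<Rightarrow>\<^sub>0 'k)) set" where
  "tens_rel T = {(r, r'). Poly_Mapping.keys r \<subseteq> fst T \<and> Poly_Mapping.keys r' \<subseteq> fst T
                          \<and> r - r' \<in> fvs.span (snd T)}"

definition tens :: "('x, 'k::field) presentation \<Rightarrow> ('x \<Rightarrow>\<^sub>0 'k) set set" where
  "tens T = {r. Poly_Mapping.keys r \<subseteq> fst T} // tens_rel T"

definition cls :: "('x, 'k::field) presentation \<Rightarrow> ('x \<Rightarrow>\<^sub>0 'k) \<Rightarrow> ('x \<Rightarrow>\<^sub>0 'k) set" where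
  "cls T r = tens_rel T `` {r}"

lemma equiv_tens_rel: "equiv {r. Poly_Mapping.keys r \<subseteq> fst T} (tens_rel T)"
proof (rule equivI)
  show "tens_rel T \<subseteq> {r. Poly_Mapping.keys r \<subseteq> fst T} \<times> {r. Poly_Mapping.keys r \<subseteq> fst T}"
    by (auto simp: tens_rel_def)
  show "refl_on {r. Poly_Mapping.keys r \<subseteq> fst T} (tens_rel T)"
    by (auto simp: refl_on_def tens_rel_def fvs.span_zero)
  have "r' - r \<in> fvs.span (snd T)" if "r - r' \<in> fvs.span (snd T)" for r r'
    using fvs.span_neg[OF that] by simp
  then show "sym (tens_rel T)"
    unfolding sym_def tens_rel_def by blast
  have "r - r'' \<in> fvs.span (snd T)"
    if "r - r' \<in> fvs.span (snd T)" "r' - r'' \<in> fvs.span (snd T)" for r r' r''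
    using fvs.span_add[OF that] by simp
  then show "trans (tens_rel T)"
    unfolding trans_def tens_rel_def by blast
qed

text \<open>The map of quotients induced by a map on formal sums; whenever the latter respects the
  relations, \<open>UN_equiv_class\<close> identifies this with the class of the image of any
  representative.\<close>

definition lift_map :: "('y, 'k::field) presentation \<Rightarrow> (('x \<Rightarrow>\<^sub>0 'k) \<Rightarrow> ('y \<Rightarrow>\<^sub>0 'k))
    \<Rightarrow> ('x \<Rightarrow>\<^sub>0 'k) set \<Rightarrow> ('y \<Rightarrow>\<^sub>0 'k) set" where
  "lift_map T F X = (\<Union>r\<in>X. cls T (F r))"

text \<open>An arbitrary representative of a coset.\<close>

definition rep :: "('x \<Rightarrow>\<^sub>0 'k::field) set \<Rightarrow> ('x \<Rightarrow>\<^sub>0 'k)" where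
  "rep X = (SOME r. r \<in> X)"

text \<open>Linearity of a map from a vector space into the quotient presented by \<open>T\<close>.\<close>

definition linear_into :: "('k::field \<Rightarrow> 'v::ab_group_add \<Rightarrow> 'v) \<Rightarrow> ('x, 'k) presentation
    \<Rightarrow> ('v \<Rightarrow> ('x \<Rightarrow>\<^sub>0 'k) set) \<Rightarrow> bool" where
  "linear_into sc T f \<longleftrightarrow>
     (\<forall>v. f v \<in> tens T) \<and>
     (\<forall>v w. f (v + w) = cls T (rep (f v) + rep (f w))) \<and>
     (\<forall>c v. f (sc c v) = cls T (fscale c (rep (f v))))"

text \<open>
  Sweedler notation.  If \<open>X\<close> is an element of a twofold tensor product, written
  \<open>x\<^sub>1 \<otimes> x\<^sub>2\<close> with summation suppressed, then \<open>sw sc f X\<close> is the sum of the \<open>f x\<^sub>1 x\<^sub>2\<close>,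
  computed from a representative; the conditions below force independence of this choice in the
  relevant quotient.  The variants \<open>swl\<close> and \<open>swr\<close> are for left coactions
  (generators \<open>([u], p)\<close>) and right coactions (generators \<open>(d, [c])\<close>).
\<close>

definition sw :: "('k::field \<Rightarrow> 'v \<Rightarrow> 'v) \<Rightarrow> ('u \<Rightarrow> 'u \<Rightarrow> 'v::ab_group_add)
    \<Rightarrow> ('u list \<Rightarrow>\<^sub>0 'k) set \<Rightarrow> 'v" where
  "sw sc f X = lext sc (\<lambda>w. f (w ! 0) (w ! 1)) (rep X)"

definition swl :: "('k::field \<Rightarrow> 'v \<Rightarrow> 'v) \<Rightarrow> ('u \<Rightarrow> 'p \<Rightarrow> 'v::ab_group_add)
    \<Rightarrow> ('u list \<times> 'p \<Rightarrow>\<^sub>0 'k) set \<Rightarrow> 'v" where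
  "swl sc f X = lext sc (\<lambda>(w, p). f (hd w) p) (rep X)"

definition swr :: "('k::field \<Rightarrow> 'v \<Rightarrow> 'v) \<Rightarrow> ('d \<Rightarrow> 'c \<Rightarrow> 'v::ab_group_add)
    \<Rightarrow> ('d \<times> 'c list \<Rightarrow>\<^sub>0 'k) set \<Rightarrow> 'v" where
  "swr sc f X = lext sc (\<lambda>(d, w). f d (hd w)) (rep X)"

text \<open>
  Relations.  A slot is a function filling one entry of a generator while the other entries are
  fixed; \<open>slot_rels\<close> expresses linearity in each slot.  \<open>bal_rels\<close> identifies pairs of
  generators.  \<open>adj n F G\<close> contains the pairs
  \<open>\<dots> \<otimes> F a u \<otimes> v \<otimes> \<dots> = \<dots> \<otimes> u \<otimes> G a v \<otimes> \<dots>\<close> on words of length \<open>n\<close>.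
\<close>

definition slot_rels :: "('k::field \<Rightarrow> 'v::ab_group_add \<Rightarrow> 'v) \<Rightarrow> ('v \<Rightarrow> 'x) set \<Rightarrow> ('x \<Rightarrow>\<^sub>0 'k) set" where
  "slot_rels sc S =
     {gen (c (v + w)) - gen (c v) - gen (c w) | c v w. c \<in> S} \<union>
     {gen (c (sc l v)) - fscale l (gen (c v)) | c l v. c \<in> S}"

definition bal_rels :: "('x \<times> 'x) set \<Rightarrow> ('x \<Rightarrow>\<^sub>0 'k::field) set" where
  "bal_rels B = {gen x - gen y | x y. (x, y) \<in> B}"

definition words :: "nat \<Rightarrow> 'u list set" where
  "words n = {w. length w = n}"

definition slots :: "nat \<Rightarrow> ('u \<Rightarrow> 'u list) set" where
  "slots n = {(\<lambda>v. xs @ v # ys) | xs ys. length xs + length ys + 1 = n}"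

definition adj :: "nat \<Rightarrow> ('a \<Rightarrow> 'u \<Rightarrow> 'u) \<Rightarrow> ('a \<Rightarrow> 'u \<Rightarrow> 'u) \<Rightarrow> ('u list \<times> 'u list) set" where
  "adj n F G = {(xs @ F a u # v # ys, xs @ u # G a v # ys) | xs ys a u v.
                length xs + length ys + 2 = n}"

text \<open>Tensor powers of \<open>U\<close>, possibly balanced; tensor powers with one further factor on the
  left or on the right.  In the latter two, \<open>E\<close> is the balancing relation involving that
  factor.\<close>

definition tpow :: "('k::field \<Rightarrow> 'u::ab_group_add \<Rightarrow> 'u) \<Rightarrow> ('u list \<times> 'u list) set \<Rightarrow> nat
    \<Rightarrow> ('u list, 'k) presentation" where
  "tpow sc B n = (words n, slot_rels sc (slots n) \<union> bal_rels B)"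

definition tpow_left :: "('k::field \<Rightarrow> 'm::ab_group_add \<Rightarrow> 'm) \<Rightarrow> ('k \<Rightarrow> 'u::ab_group_add \<Rightarrow> 'u)
    \<Rightarrow> (('m \<times> 'u list) \<times> ('m \<times> 'u list)) set \<Rightarrow> ('u list \<times> 'u list) set \<Rightarrow> nat
    \<Rightarrow> ('m \<times> 'u list, 'k) presentation" where
  "tpow_left scm sc E B n =
     (UNIV \<times> words n,
      slot_rels scm {(\<lambda>m. (m, w)) | w. w \<in> words n} \<union>
      slot_rels sc {(\<lambda>v. (m, c v)) | m c. c \<in> slots n} \<union>
      bal_rels E \<union> bal_rels {((m, w), (m, w')) | m w w'. (w, w') \<in> B})"

definition tpow_right :: "('k::field \<Rightarrow> 'm::ab_group_add \<Rightarrow> 'm) \<Rightarrow> ('k \<Rightarrow> 'u::ab_group_add \<Rightarrow> 'u)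
    \<Rightarrow> (('u list \<times> 'm) \<times> ('u list \<times> 'm)) set \<Rightarrow> ('u list \<times> 'u list) set \<Rightarrow> nat
    \<Rightarrow> ('u list \<times> 'm, 'k) presentation" where
  "tpow_right scm sc E B n =
     (words n \<times> UNIV,
      slot_rels scm {(\<lambda>m. (w, m)) | w. w \<in> words n} \<union>
      slot_rels sc {(\<lambda>v. (c v, m)) | m c. c \<in> slots n} \<union>
      bal_rels E \<union> bal_rels {((w, m), (w', m)) | m w w'. (w, w') \<in> B})"


section \<open>Algebras, coalgebras and comodules over a field\<close>

text \<open>The sort of \<open>'r\<close> is that of unital rings; unlike \<open>ring_1\<close> it admits the zero ring.\<close>

locale k_algebra = vector_space sc
  for sc :: "'k::field \<Rightarrow> 'r::{ring, monoid_mult} \<Rightarrow> 'r" +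
  assumes scale_mult_left: "sc c (a * b) = sc c a * b"
    and scale_mult_right: "sc c (a * b) = a * sc c b"

record (overloaded) ('k, 'c) coalgebra_data =
  csc :: "'k \<Rightarrow> 'c \<Rightarrow> 'c"
  ccop :: "'c \<Rightarrow> ('c list \<Rightarrow>\<^sub>0 'k) set"
  ccou :: "'c \<Rightarrow> 'k"

locale coalgebra = vector_space "csc C"
  for C :: "('k::field, 'c::ab_group_add) coalgebra_data" +
  assumes cop_linear: "linear_into (csc C) (tpow (csc C) {} 2) (ccop C)"
    and cou_linear: "Vector_Spaces.linear (csc C) (*) (ccou C)"
    and coassoc:
      "(sw fscale (\<lambda>x y. sw fscale (\<lambda>x' x''. gen [x', x'', y]) (ccop C x)) (ccop C z),
        sw fscale (\<lambda>x y. sw fscale (\<lambda>y' y''. gen [x, y', y'']) (ccop C y)) (ccop C z))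
       \<in> tens_rel (tpow (csc C) {} 3)"
    and counit_left: "sw (csc C) (\<lambda>x y. csc C (ccou C x) y) (ccop C z) = z"
    and counit_right: "sw (csc C) (\<lambda>x y. csc C (ccou C y) x) (ccop C z) = z"

locale cocommutative_coalgebra = coalgebra C
  for C :: "('k::field, 'c::ab_group_add) coalgebra_data" +
  assumes cocommutative: "ccop C z = cls (tpow (csc C) {} 2) (sw fscale (\<lambda>x y. gen [y, x]) (ccop C z))"

record (overloaded) ('k, 'c, 'd) comodule_data =
  dsc :: "'k \<Rightarrow> 'd \<Rightarrow> 'd"
  dcoact :: "'d \<Rightarrow> ('d \<times> 'c list \<Rightarrow>\<^sub>0 'k) set"

locale right_comodule = coalgebra C + comodule: vector_space "dsc D"
  for C :: "('k::field, 'c::ab_group_add) coalgebra_data"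
    and D :: "('k, 'c, 'd::ab_group_add) comodule_data" +
  assumes coact_linear: "linear_into (dsc D) (tpow_left (dsc D) (csc C) {} {} 1) (dcoact D)"
    and coact_coassoc:
      "(swr fscale (\<lambda>y x. swr fscale (\<lambda>y' x'. gen (y', [x', x])) (dcoact D y)) (dcoact D z),
        swr fscale (\<lambda>y x. sw fscale (\<lambda>x' x''. gen (y, [x', x''])) (ccop C x)) (dcoact D z))
       \<in> tens_rel (tpow_left (dsc D) (csc C) {} {} 2)"
    and coact_counit: "swr (dsc D) (\<lambda>y x. dsc D (ccou C x) y) (dcoact D z) = z"

text \<open>The iterated coaction \<open>y\<^sub>0 \<otimes> y\<^sub>1 \<otimes> \<dots> \<otimes> y\<^sub>n\<close>, as a formal sum.\<close>

fun iter_coact :: "('k::field, 'c, 'd) comodule_data \<Rightarrow> nat \<Rightarrow> 'd \<Rightarrow> ('d \<times> 'c list \<Rightarrow>\<^sub>0 'k)" where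
  "iter_coact D 0 y = gen (y, [])"
| "iter_coact D (Suc n) y =
     lext fscale (\<lambda>(z, w). swr fscale (\<lambda>z' x. gen (z', x # w)) (dcoact D z)) (iter_coact D n y)"


section \<open>Hopf algebroids\<close>

record (overloaded) ('k, 'u, 'a) bialgebroid_data =
  usc :: "'k \<Rightarrow> 'u \<Rightarrow> 'u"
  asc :: "'k \<Rightarrow> 'a \<Rightarrow> 'a"
  src :: "'a \<Rightarrow> 'u"
  tgt :: "'a \<Rightarrow> 'u"
  ucop :: "'u \<Rightarrow> ('u list \<Rightarrow>\<^sub>0 'k) set"
  ucou :: "'u \<Rightarrow> 'a"

record (overloaded) ('k, 'u, 'a) hopf_algebroid_data = "('k, 'u, 'a) bialgebroid_data" +
  anti :: "'u \<Rightarrow> 'u"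

text \<open>\<open>U \<otimes>\<^sub>A \<dots> \<otimes>\<^sub>A U\<close>, with relations \<open>t(a)u \<otimes> v = u \<otimes> s(a)v\<close>.\<close>

definition bal_A :: "('k, 'u::times, 'a, 'z) bialgebroid_data_scheme \<Rightarrow> nat \<Rightarrow> ('u list \<times> 'u list) set" where
  "bal_A H n = adj n (\<lambda>a u. tgt H a * u) (\<lambda>a v. src H a * v)"

definition UA :: "('k::field, 'u::ring, 'a, 'z) bialgebroid_data_scheme \<Rightarrow> nat
    \<Rightarrow> ('u list, 'k) presentation" where
  "UA H n = tpow (usc H) (bal_A H n) n"

text \<open>The same with respect to \<open>A\<^sup>o\<^sup>p\<close>, with relations \<open>u t(a) \<otimes> v = u \<otimes> t(a)v\<close>.\<close>

definition bal_Aop :: "('k, 'u::times, 'a, 'z) bialgebroid_data_scheme \<Rightarrow> nat \<Rightarrow> ('u list \<times> 'u list) set" where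
  "bal_Aop H n = adj n (\<lambda>a u. u * tgt H a) (\<lambda>a v. tgt H a * v)"

definition UAop :: "('k::field, 'u::ring, 'a, 'z) bialgebroid_data_scheme \<Rightarrow> nat
    \<Rightarrow> ('u list, 'k) presentation" where
  "UAop H n = tpow (usc H) (bal_Aop H n) n"

locale left_bialgebroid = U: k_algebra "usc H" + A: k_algebra "asc H"
  for H :: "('k::field, 'u::{ring, monoid_mult}, 'a::{ring, monoid_mult}, 'z) bialgebroid_data_scheme" +
  assumes src_linear: "Vector_Spaces.linear (asc H) (usc H) (src H)"
    and src_mult: "src H (a * b) = src H a * src H b"
    and src_one: "src H 1 = 1"
    and tgt_linear: "Vector_Spaces.linear (asc H) (usc H) (tgt H)"
    and tgt_mult: "tgt H (a * b) = tgt H b * tgt H a"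
    and tgt_one: "tgt H 1 = 1"
    and src_tgt_commute: "src H a * tgt H b = tgt H b * src H a"
    \<comment> \<open>coalgebra in \<open>(A, A)\<close>-bimodules\<close>
    and ucop_linear: "linear_into (usc H) (UA H 2) (ucop H)"
    and ucop_bimodule: "ucop H (src H a * tgt H b * u) =
      cls (UA H 2) (sw fscale (\<lambda>u1 u2. gen [src H a * u1, tgt H b * u2]) (ucop H u))"
    and ucou_linear: "Vector_Spaces.linear (usc H) (asc H) (ucou H)"
    and ucou_bimodule: "ucou H (src H a * tgt H b * u) = a * ucou H u * b"
    and ucop_coassoc:
      "(sw fscale (\<lambda>u1 u2. sw fscale (\<lambda>v1 v2. gen [v1, v2, u2]) (ucop H u1)) (ucop H u),
        sw fscale (\<lambda>u1 u2. sw fscale (\<lambda>v1 v2. gen [u1, v1, v2]) (ucop H u2)) (ucop H u))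
       \<in> tens_rel (UA H 3)"
    and ucounit_left: "sw (usc H) (\<lambda>u1 u2. src H (ucou H u1) * u2) (ucop H u) = u"
    and ucounit_right: "sw (usc H) (\<lambda>u1 u2. tgt H (ucou H u2) * u1) (ucop H u) = u"
    \<comment> \<open>\<open>\<Delta>\<close> is a unital algebra morphism into the Takeuchi product\<close>
    and ucop_takeuchi:
      "(sw fscale (\<lambda>u1 u2. gen [u1 * tgt H a, u2]) (ucop H u),
        sw fscale (\<lambda>u1 u2. gen [u1, u2 * src H a]) (ucop H u)) \<in> tens_rel (UA H 2)"
    and ucop_mult: "ucop H (u * v) = cls (UA H 2)
      (sw fscale (\<lambda>u1 u2. sw fscale (\<lambda>v1 v2. gen [u1 * v1, u2 * v2]) (ucop H v)) (ucop H u))"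
    and ucop_one: "ucop H 1 = cls (UA H 2) (gen [1, 1])"
    and ucou_src: "ucou H (u * src H (ucou H v)) = ucou H (u * v)"
    and ucou_tgt: "ucou H (u * tgt H (ucou H v)) = ucou H (u * v)"

locale hopf_algebroid = left_bialgebroid H
  for H :: "('k::field, 'u::{ring, monoid_mult}, 'a::{ring, monoid_mult}, 'z) hopf_algebroid_data_scheme" +
  assumes anti_linear: "Vector_Spaces.linear (usc H) (usc H) (anti H)"
    and anti_mult: "anti H (u * v) = anti H v * anti H u"
    and anti_one: "anti H 1 = 1"
    and anti_involutive: "anti H (anti H u) = u"
    and anti_tgt: "anti H (tgt H a) = src H a"
    and anti_left:
      "(sw fscale (\<lambda>u1 u2. sw fscale (\<lambda>v1 v2. gen [v1 * u2, v2]) (ucop H (anti H u1))) (ucop H u),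
        gen [1, anti H u]) \<in> tens_rel (UA H 2)"
    and anti_right:
      "(sw fscale (\<lambda>u1 u2. sw fscale (\<lambda>v1 v2. gen [v1, v2 * u1]) (ucop H (anti H u2))) (ucop H u),
        gen [anti H u, 1]) \<in> tens_rel (UA H 2)"

text \<open>The map \<open>\<beta>(u \<otimes> v) = u\<^sub>1 \<otimes> u\<^sub>2 v\<close> and \<open>u\<^sub>+ \<otimes> u\<^sub>- = \<beta>\<^sup>-\<^sup>1(u \<otimes> 1)\<close>;
  for a Hopf algebroid \<open>\<beta>\<close> is a bijection from \<open>U \<otimes>\<^sub>A\<^sub>o\<^sub>p U\<close> onto \<open>U \<otimes>\<^sub>A U\<close>.\<close>

definition beta :: "('k::field, 'u::{ring, monoid_mult}, 'a, 'z) bialgebroid_data_scheme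
    \<Rightarrow> ('u list \<Rightarrow>\<^sub>0 'k) set \<Rightarrow> ('u list \<Rightarrow>\<^sub>0 'k) set" where
  "beta H = lift_map (UA H 2)
     (lext fscale (\<lambda>w. sw fscale (\<lambda>u1 u2. gen [u1, u2 * w ! 1]) (ucop H (w ! 0))))"

definition plus_minus :: "('k::field, 'u::{ring, monoid_mult}, 'a, 'z) bialgebroid_data_scheme
    \<Rightarrow> 'u \<Rightarrow> ('u list \<Rightarrow>\<^sub>0 'k) set" where
  "plus_minus H u = inv_into (tens (UAop H 2)) (beta H) (cls (UA H 2) (gen [u, 1]))"


section \<open>SAYD modules\<close>

record (overloaded) ('k, 'u, 'a, 'p) sayd_data =
  psc :: "'k \<Rightarrow> 'p \<Rightarrow> 'p"
  ract :: "'p \<Rightarrow> 'u \<Rightarrow> 'p"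
  lact :: "'a \<Rightarrow> 'p \<Rightarrow> 'p"
  pcoact :: "'p \<Rightarrow> ('u list \<times> 'p \<Rightarrow>\<^sub>0 'k) set"

text \<open>\<open>C\<^sub>n(U; P)\<close> and \<open>C\<^sup>n(U; P)\<close>; for \<open>n = 1\<close> the latter is \<open>U \<otimes>\<^sub>A P\<close>.\<close>

definition Clow :: "('k::field, 'u::ring, 'a, 'z) bialgebroid_data_scheme
    \<Rightarrow> ('k, 'u, 'a, 'p::ab_group_add) sayd_data \<Rightarrow> nat \<Rightarrow> ('p \<times> 'u list, 'k) presentation" where
  "Clow H P n = tpow_left (psc P) (usc H)
     {((ract P p (tgt H a), u # us), (p, tgt H a * u # us)) | p a u us. length us + 1 = n}
     (bal_Aop H n) n"

definition Cup :: "('k::field, 'u::ring, 'a, 'z) bialgebroid_data_scheme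
    \<Rightarrow> ('k, 'u, 'a, 'p::ab_group_add) sayd_data \<Rightarrow> nat \<Rightarrow> ('u list \<times> 'p, 'k) presentation" where
  "Cup H P n = tpow_right (psc P) (usc H)
     {((us @ [tgt H a * u], p), (us @ [u], lact P a p)) | p a u us. length us + 1 = n}
     (bal_A H n) n"

locale sayd_module = hopf_algebroid H + module: vector_space "psc P"
  for H :: "('k::field, 'u::{ring, monoid_mult}, 'a::{ring, monoid_mult}, 'z) hopf_algebroid_data_scheme"
    and P :: "('k, 'u, 'a, 'p::ab_group_add) sayd_data" +
  assumes ract_linear: "Vector_Spaces.linear (psc P) (psc P) (\<lambda>p. ract P p u)"
      "Vector_Spaces.linear (usc H) (psc P) (\<lambda>u. ract P p u)"
    and ract_mult: "ract P p (u * v) = ract P (ract P p u) v"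
    and ract_one: "ract P p 1 = p"
    and lact_linear: "Vector_Spaces.linear (psc P) (psc P) (\<lambda>p. lact P a p)"
      "Vector_Spaces.linear (asc H) (psc P) (\<lambda>a. lact P a p)"
    and lact_mult: "lact P (a * b) p = lact P a (lact P b p)"
    and lact_one: "lact P 1 p = p"
    and pcoact_linear: "linear_into (psc P) (Cup H P 1) (pcoact P)"
    and pcoact_lact: "pcoact P (lact P a p) =
      cls (Cup H P 1) (swl fscale (\<lambda>v q. gen ([src H a * v], q)) (pcoact P p))"
    and pcoact_coassoc:
      "(swl fscale (\<lambda>v q. sw fscale (\<lambda>v1 v2. gen ([v1, v2], q)) (ucop H v)) (pcoact P p),
        swl fscale (\<lambda>v q. swl fscale (\<lambda>v' q'. gen ([v, v'], q')) (pcoact P q)) (pcoact P p))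
       \<in> tens_rel (Cup H P 2)"
    and pcoact_counit: "swl (psc P) (\<lambda>v q. lact P (ucou H v) q) (pcoact P p) = p"
    and ract_src_tgt: "ract P p (src H a * tgt H b) =
      swl (psc P) (\<lambda>v q. lact P (b * ucou H (v * src H a)) q) (pcoact P p)"
    and anti_yetter_drinfeld: "pcoact P (ract P p u) = cls (Cup H P 1)
      (sw fscale (\<lambda>up um.
         sw fscale (\<lambda>up1 up2.
           swl fscale (\<lambda>v q. gen ([um * v * up1], ract P q up2)) (pcoact P p))
         (ucop H up))
       (plus_minus H u))"
    and stable: "swl (psc P) (\<lambda>v q. ract P q v) (pcoact P p) = p"


section \<open>Measurings\<close>

definition linear_family :: "('k::field \<Rightarrow> 'c::ab_group_add \<Rightarrow> 'c) \<Rightarrow> ('k \<Rightarrow> 'v::ab_group_add \<Rightarrow> 'v)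
    \<Rightarrow> ('k \<Rightarrow> 'w::ab_group_add \<Rightarrow> 'w) \<Rightarrow> ('c \<Rightarrow> 'v \<Rightarrow> 'w) \<Rightarrow> bool" where
  "linear_family sc1 sc2 sc3 f \<longleftrightarrow>
     (\<forall>x. Vector_Spaces.linear sc2 sc3 (f x)) \<and> (\<forall>v. Vector_Spaces.linear sc1 sc3 (\<lambda>x. f x v))"

definition algebra_measuring :: "('k::field, 'c::ab_group_add) coalgebra_data
    \<Rightarrow> ('k \<Rightarrow> 'r::{ring, monoid_mult} \<Rightarrow> 'r) \<Rightarrow> ('k \<Rightarrow> 's::{ring, monoid_mult} \<Rightarrow> 's)
    \<Rightarrow> ('c \<Rightarrow> 'r \<Rightarrow> 's) \<Rightarrow> bool" where
  "algebra_measuring C sc sc' \<psi> \<longleftrightarrow>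
     linear_family (csc C) sc sc' \<psi> \<and>
     (\<forall>x a b. \<psi> x (a * b) = sw sc' (\<lambda>x1 x2. \<psi> x1 a * \<psi> x2 b) (ccop C x)) \<and>
     (\<forall>x. \<psi> x 1 = sc' (ccou C x) 1)"

definition Vmaps :: "('k::field, 'u::{ring, monoid_mult}, 'a::{ring, monoid_mult}, 'z) hopf_algebroid_data_scheme
    \<Rightarrow> ('k, 'u2::{ring, monoid_mult}, 'a2::{ring, monoid_mult}, 'z2) hopf_algebroid_data_scheme
    \<Rightarrow> (('u \<Rightarrow> 'u2) \<times> ('a \<Rightarrow> 'a2)) set" where
  "Vmaps H H' = {(F, f).
     Vector_Spaces.linear (usc H) (usc H') F \<and> Vector_Spaces.linear (asc H) (asc H') f \<and>
     (\<forall>a. F (src H a) = src H' (f a)) \<and> (\<forall>a. F (tgt H a) = tgt H' (f a)) \<and>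
     (\<forall>u. F (anti H u) = anti H' (F u)) \<and> (\<forall>u. f (ucou H u) = ucou H' (F u))}"

definition hopf_algebroid_measuring :: "('k::field, 'c::ab_group_add) coalgebra_data
    \<Rightarrow> ('k, 'u::{ring, monoid_mult}, 'a::{ring, monoid_mult}, 'z) hopf_algebroid_data_scheme
    \<Rightarrow> ('k, 'u2::{ring, monoid_mult}, 'a2::{ring, monoid_mult}, 'z2) hopf_algebroid_data_scheme
    \<Rightarrow> ('c \<Rightarrow> 'u \<Rightarrow> 'u2) \<Rightarrow> ('c \<Rightarrow> 'a \<Rightarrow> 'a2) \<Rightarrow> bool" where
  "hopf_algebroid_measuring C H H' \<Psi> \<psi> \<longleftrightarrow>
     algebra_measuring C (usc H) (usc H') \<Psi> \<and> algebra_measuring C (asc H) (asc H') \<psi> \<and>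
     (\<forall>x. (\<Psi> x, \<psi> x) \<in> Vmaps H H') \<and>
     (\<forall>x u. ucop H' (\<Psi> x u) = cls (UA H' 2)
        (sw fscale (\<lambda>x1 x2. sw fscale (\<lambda>u1 u2. gen [\<Psi> x1 u1, \<Psi> x2 u2]) (ucop H u)) (ccop C x)))"

text \<open>The defining equations of a \<open>(C, \<Psi>, \<psi>)\<close>-comodule measuring do not mention \<open>\<psi>\<close>; \<open>C\<close> enters
  through the type of the coaction of \<open>D\<close>.\<close>

definition comodule_measuring :: "('k::field, 'c::ab_group_add, 'd::ab_group_add) comodule_data
    \<Rightarrow> ('k, 'u::{ring, monoid_mult}, 'a, 'p::ab_group_add) sayd_data
    \<Rightarrow> ('k, 'u2::{ring, monoid_mult}, 'a2, 'z2) bialgebroid_data_scheme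
    \<Rightarrow> ('k, 'u2, 'a2, 'p2::ab_group_add) sayd_data
    \<Rightarrow> ('c \<Rightarrow> 'u \<Rightarrow> 'u2) \<Rightarrow> ('d \<Rightarrow> 'p \<Rightarrow> 'p2) \<Rightarrow> bool" where
  "comodule_measuring D P H' P' \<Psi> \<Omega> \<longleftrightarrow>
     linear_family (dsc D) (psc P) (psc P') \<Omega> \<and>
     (\<forall>y p u. \<Omega> y (ract P p u) =
        swr (psc P') (\<lambda>y0 y1. ract P' (\<Omega> y0 p) (\<Psi> y1 u)) (dcoact D y)) \<and>
     (\<forall>y p. pcoact P' (\<Omega> y p) = cls (Cup H' P' 1)
        (swr fscale (\<lambda>y0 y1. swl fscale (\<lambda>v q. gen ([\<Psi> y1 v], \<Omega> y0 q)) (pcoact P p)) (dcoact D y)))"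

definition Omega_low :: "('k::field, 'c, 'd) comodule_data
    \<Rightarrow> ('k, 'u2::ring, 'a2, 'z2) bialgebroid_data_scheme \<Rightarrow> ('k, 'u2, 'a2, 'p2::ab_group_add) sayd_data
    \<Rightarrow> ('c \<Rightarrow> 'u \<Rightarrow> 'u2) \<Rightarrow> ('d \<Rightarrow> 'p \<Rightarrow> 'p2) \<Rightarrow> nat \<Rightarrow> 'd
    \<Rightarrow> ('p \<times> 'u list \<Rightarrow>\<^sub>0 'k) set \<Rightarrow> ('p2 \<times> 'u2 list \<Rightarrow>\<^sub>0 'k) set" where
  "Omega_low D H' P' \<Psi> \<Omega> n y = lift_map (Clow H' P' n)
     (lext fscale (\<lambda>(p, us). lext fscale (\<lambda>(z, xs). gen (\<Omega> z p, map2 \<Psi> xs us)) (iter_coact D n y)))"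

definition Omega_up :: "('k::field, 'c, 'd) comodule_data
    \<Rightarrow> ('k, 'u2::ring, 'a2, 'z2) bialgebroid_data_scheme \<Rightarrow> ('k, 'u2, 'a2, 'p2::ab_group_add) sayd_data
    \<Rightarrow> ('c \<Rightarrow> 'u \<Rightarrow> 'u2) \<Rightarrow> ('d \<Rightarrow> 'p \<Rightarrow> 'p2) \<Rightarrow> nat \<Rightarrow> 'd
    \<Rightarrow> ('u list \<times> 'p \<Rightarrow>\<^sub>0 'k) set \<Rightarrow> ('u2 list \<times> 'p2 \<Rightarrow>\<^sub>0 'k) set" where
  "Omega_up D H' P' \<Psi> \<Omega> n y = lift_map (Cup H' P' n)
     (lext fscale (\<lambda>(us, p). lext fscale (\<lambda>(z, xs). gen (map2 \<Psi> xs us, \<Omega> z p)) (iter_coact D n y)))"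


section \<open>The Hopf-Galois map\<close>

text \<open>\<open>iter_cop H m u\<close> is the formal sum \<open>u\<^sub>1 \<otimes> \<dots> \<otimes> u\<^sub>m\<^sub>+\<^sub>1\<close>.\<close>

fun iter_cop :: "('k::field, 'u, 'a, 'z) bialgebroid_data_scheme \<Rightarrow> nat \<Rightarrow> 'u \<Rightarrow> ('u list \<Rightarrow>\<^sub>0 'k)" where
  "iter_cop H 0 u = gen [u]"
| "iter_cop H (Suc m) u =
     lext fscale (\<lambda>w. sw fscale (\<lambda>v1 v2. gen (v1 # v2 # tl w)) (ucop H (hd w))) (iter_cop H m u)"

text \<open>
  The word \<open>u\<^sup>1\<^sub>1 \<otimes> u\<^sup>1\<^sub>2 u\<^sup>2\<^sub>1 \<otimes> \<dots> \<otimes> u\<^sup>1\<^sub>n u\<^sup>2\<^sub>n\<^sub>-\<^sub>1 \<dots> u\<^sup>n\<close> is the factorwise product of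
  \<open>u\<^sup>1\<^sub>1 \<otimes> \<dots> \<otimes> u\<^sup>1\<^sub>n\<close> with \<open>1 \<otimes> z\<close>, where \<open>z\<close> is the corresponding word for \<open>u\<^sup>2, \<dots>, u\<^sup>n\<close>.
\<close>

fun xi_word :: "('k::field, 'u::{ring, monoid_mult}, 'a, 'z) bialgebroid_data_scheme
    \<Rightarrow> 'u list \<Rightarrow> ('u list \<Rightarrow>\<^sub>0 'k)" where
  "xi_word H [] = gen []"
| "xi_word H (u # us) =
     lext fscale (\<lambda>w. lext fscale (\<lambda>z. gen (map2 (*) w (1 # z))) (xi_word H us))
       (iter_cop H (length us) u)"

definition xi :: "('k::field, 'u::{ring, monoid_mult}, 'a, 'z) bialgebroid_data_scheme
    \<Rightarrow> ('k, 'u, 'a, 'p::ab_group_add) sayd_data \<Rightarrow> nat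
    \<Rightarrow> ('p \<times> 'u list \<Rightarrow>\<^sub>0 'k) set \<Rightarrow> ('u list \<times> 'p \<Rightarrow>\<^sub>0 'k) set" where
  "xi H P n = lift_map (Cup H P n)
     (lext fscale (\<lambda>(p, us). lext fscale (\<lambda>w. gen (w, p)) (xi_word H us)))"

end

theory Submission
  imports Defs
begin

text \<open>
  Two formal sums are equal in a quotient of a free vector space iff every \<open>k\<close>-valued functional
  killing the relations agrees on them, so all identities between tensors are tested against
  multilinear balanced functions on words, on which the structure maps act by substitution.

  The map \<open>\<xi>\<^sub>n\<close> is well defined because of the iterated Takeuchi condition and because
  \<open>p t(a) = a p\<close> in an SAYD module.  The same identity, in \<open>P\<close> and in \<open>P'\<close>, shows that the
  measuring \<open>\<Omega>\<close> is compatible with the left \<open>A\<close>-action, and hence that \<open>\<Omega>\<^sup>n(y)\<close> is well defined.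
  Since \<open>y\<^sub>0 \<otimes> \<dots> \<otimes> y\<^sub>n\<close> is \<open>y\<^sub>0\<close> tensored with the iterated coproduct of \<open>y\<^sub>1\<close>, the theorem
  reduces to a statement about \<open>x \<in> C\<close> acting on words in \<open>U\<close>.  It follows by induction on the
  word: \<open>x\<close> respects iterated coproducts of \<open>U\<close> by coassociativity, and factorwise products of
  words because cocommutativity makes the coproduct of \<open>C\<close> a coalgebra map.
\<close>

section \<open>Linear functionals and quotients\<close>

abbreviation ev :: "('x \<Rightarrow> 'k::field) \<Rightarrow> ('x \<Rightarrow>\<^sub>0 'k) \<Rightarrow> 'k" where
  "ev f r \<equiv> lext (*) f r"

text \<open>Just the two equations: unlike \<open>Vector_Spaces.linear\<close>, the predicate
  carries no vector space axioms for \<open>sc\<close>, so none have to be discharged when test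
  functions are built.\<close>

definition lin :: "('k::field \<Rightarrow> 'v::ab_group_add \<Rightarrow> 'v) \<Rightarrow> ('v \<Rightarrow> 'k) \<Rightarrow> bool" where
  "lin sc f \<longleftrightarrow> (\<forall>v w. f (v + w) = f v + f w) \<and> (\<forall>c v. f (sc c v) = c * f v)"

lemma linI:
  assumes "\<And>v w. f (v + w) = f v + f w" and "\<And>c v. f (sc c v) = c * f v"
  shows "lin sc f"
  using assms by (simp add: lin_def)

lemma lin_add: "lin sc f \<Longrightarrow> f (v + w) = f v + f w"
  and lin_scale: "lin sc f \<Longrightarrow> f (sc c v) = c * f v"
  by (simp_all add: lin_def)

lemma lin_zero: "lin sc f \<Longrightarrow> f 0 = 0"
  using lin_add[of sc f 0 0] by (metis add.right_neutral add_left_cancel)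

lemma lin_compose:
  assumes "Vector_Spaces.linear sc sc' g" and "lin sc' f"
  shows "lin sc (\<lambda>v. f (g v))"
proof -
  interpret g: Vector_Spaces.linear sc sc' g by fact
  show ?thesis by (rule linI) (simp_all add: g.add g.scale lin_add[OF assms(2)] lin_scale[OF assms(2)])
qed

lemma lin_linear:
  assumes "Vector_Spaces.linear sc (*) f"
  shows "lin sc f"
proof -
  interpret f: Vector_Spaces.linear sc "(*)" f by fact
  show ?thesis by (rule linI) (simp_all add: f.add f.scale)
qed

lemma lin_mult_right: "lin sc f \<Longrightarrow> lin sc (\<lambda>v. f v * c)"
  by (simp add: lin_def algebra_simps)

lemma lin_lext: "lin sc L \<Longrightarrow> L (lext sc f r) = ev (\<lambda>x. L (f x)) r"
proof -
  assume L: "lin sc L"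
  have "L (\<Sum>x\<in>S. sc (c x) (f x)) = (\<Sum>x\<in>S. c x * L (f x))" if "finite S" for S c
    using that by induction (simp_all add: lin_zero[OF L] lin_add[OF L] lin_scale[OF L])
  then show ?thesis by (simp add: lext_def)
qed

lemma ev_superset:
  assumes "finite S" "Poly_Mapping.keys r \<subseteq> S"
  shows "ev f r = (\<Sum>x\<in>S. Poly_Mapping.lookup r x * f x)"
  unfolding lext_def using assms by (intro sum.mono_neutral_left) (auto simp: in_keys_iff)

lemma ev_add: "ev f (r + s) = ev f r + ev f s"
proof -
  define S where "S = Poly_Mapping.keys r \<union> Poly_Mapping.keys s"
  have "finite S" "Poly_Mapping.keys r \<subseteq> S" "Poly_Mapping.keys s \<subseteq> S" "Poly_Mapping.keys (r + s) \<subseteq> S"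
    using Poly_Mapping.keys_add[of r s] by (auto simp: S_def)
  then show ?thesis
    by (simp add: ev_superset[of S] lookup_add distrib_right sum.distrib)
qed

lemma keys_fscale: "Poly_Mapping.keys (fscale c r) \<subseteq> Poly_Mapping.keys r"
  by (auto simp: in_keys_iff lookup_fscale)

lemma ev_fscale: "ev f (fscale c r) = c * ev f r"
  using ev_superset[OF _ keys_fscale, of r f c]
  by (simp add: lookup_fscale lext_def sum_distrib_left mult.assoc)

lemma lin_ev_arg: "lin fscale (ev f)"
  by (rule linI) (rule ev_add ev_fscale)+

lemma ev_diff: "ev f (r - s) = ev f r - ev f s"
  using ev_add[of f "r - s" s] by simp

lemma ev_single [simp]: "ev f (Poly_Mapping.single x c) = c * f x"
  by (simp add: lext_def)

lemma ev_lext: "ev f (lext fscale g r) = ev (\<lambda>x. ev f (g x)) r"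
  by (rule lin_lext[OF lin_ev_arg])

lemma ev_cong: "(\<And>x. x \<in> Poly_Mapping.keys r \<Longrightarrow> f x = g x) \<Longrightarrow> ev f r = ev g r"
  unfolding lext_def by (rule sum.cong) auto

lemma ev_swap: "ev (\<lambda>x. ev (f x) s) r = ev (\<lambda>y. ev (\<lambda>x. f x y) r) s"
  unfolding lext_def sum_distrib_left
  by (subst sum.swap) (simp add: mult.left_commute)

text \<open>The premise is restricted to generators occurring in \<open>r\<close> because test
  functions are multilinear only on words of the right length, and that length is known from the
  keys of \<open>r\<close>.\<close>

lemma lin_ev:
  assumes "\<And>x. x \<in> Poly_Mapping.keys r \<Longrightarrow> lin sc (\<lambda>v. f v x)"
  shows "lin sc (\<lambda>v. ev (f v) r)"
proof (rule linI)
  fix v w c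
  have "ev (f (v + w)) r = ev (\<lambda>x. f v x + f w x) r"
    by (rule ev_cong) (rule lin_add[OF assms])
  then show "ev (f (v + w)) r = ev (f v) r + ev (f w) r"
    by (simp add: lext_def distrib_left sum.distrib)
  have "ev (f (sc c v)) r = ev (\<lambda>x. c * f v x) r"
    by (rule ev_cong) (rule lin_scale[OF assms])
  then show "ev (f (sc c v)) r = c * ev (f v) r"
    by (simp add: lext_def sum_distrib_left mult.left_commute)
qed

lemma keys_lext:
  assumes "\<And>x. x \<in> Poly_Mapping.keys r \<Longrightarrow> Poly_Mapping.keys (g x) \<subseteq> S"
  shows "Poly_Mapping.keys (lext fscale g r) \<subseteq> S"
proof -
  have "Poly_Mapping.keys (lext fscale g r)
      \<subseteq> (\<Union>x\<in>Poly_Mapping.keys r. Poly_Mapping.keys (fscale (Poly_Mapping.lookup r x) (g x)))"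
    unfolding lext_def by (rule keys_sum)
  also have "\<dots> \<subseteq> S"
    using assms keys_fscale by fastforce
  finally show ?thesis .
qed

section \<open>Functionals that descend to a quotient, and equality tested by them\<close>

definition adm :: "('x, 'k::field) presentation \<Rightarrow> ('x \<Rightarrow> 'k) \<Rightarrow> bool" where
  "adm T f \<longleftrightarrow> (\<forall>s\<in>snd T. ev f s = 0)"

text \<open>If \<open>r\<close> lies outside the span, a basis \<open>B\<close> of the span stays
  independent after adjoining \<open>r\<close>, so some functional is 1 at \<open>r\<close> and
  vanishes on \<open>B\<close>, hence on all relations. The converse is linearity.\<close>

lemma span_iff_functionals:
  fixes R :: "('x \<Rightarrow>\<^sub>0 'k::field) set"
  shows "r \<in> fvs.span R \<longleftrightarrow> (\<forall>f. (\<forall>s\<in>R. ev f s = 0) \<longrightarrow> ev f r = 0)"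
proof (intro iffI allI impI)
  fix f :: "'x \<Rightarrow> 'k"
  assume "r \<in> fvs.span R" and f: "\<forall>s\<in>R. ev f s = 0"
  then show "ev f r = 0"
    by (induction rule: fvs.span_induct_alt)
      (simp_all add: lin_zero[OF lin_ev_arg] ev_add ev_fscale)
next
  assume *: "\<forall>f. (\<forall>s\<in>R. ev f s = 0) \<longrightarrow> ev f r = 0"
  interpret vp: vector_space_pair "fscale :: 'k \<Rightarrow> ('x \<Rightarrow>\<^sub>0 'k) \<Rightarrow> _" "(*) :: 'k \<Rightarrow> 'k \<Rightarrow> 'k"
    by unfold_locales (simp_all add: algebra_simps)
  show "r \<in> fvs.span R"
  proof (rule ccontr)
    assume r: "r \<notin> fvs.span R"
    obtain B where B: "B \<subseteq> R" "fvs.independent B" "R \<subseteq> fvs.span B"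
      using fvs.maximal_independent_subset[of R] by blast
    have rB: "r \<notin> fvs.span B"
      using r fvs.span_mono[OF B(1)] by blast
    then have "fvs.independent (insert r B)"
      using B(2) by (simp add: fvs.independent_insert)
    then obtain g where g: "Vector_Spaces.linear fscale (*) g"
      and gv: "\<forall>x\<in>insert r B. g x = (if x = r then 1 else 0)"
      using vp.linear_independent_extend[of "insert r B" "\<lambda>x. if x = r then 1 else 0"] by blast
    \<comment> \<open>A functional on the free space is recovered from its values on generators, so
      \<open>g\<close> has the form \<open>ev f\<close> that the hypothesis speaks of.\<close>
    have g_ev: "g s = ev (\<lambda>x. g (gen x)) s" for s
    proof -
      have "s = lext fscale gen s"
        by (rule poly_mapping_eqI)
          (auto simp: lext_def lookup_sum lookup_fscale lookup_single when_def in_keys_iff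
            if_distrib[of "(*) _"] sum.delta' cong: if_cong)
      then show ?thesis
        using lin_lext[OF lin_linear[OF g], of gen s] by metis
    qed
    have "g s = 0" if "s \<in> fvs.span B" for s
      using that by (induction rule: fvs.span_induct_alt)
       (use gv rB fvs.span_base in \<open>auto simp: lin_zero[OF lin_linear[OF g]] lin_add[OF lin_linear[OF g]]
           lin_scale[OF lin_linear[OF g]]\<close>)
    then have "\<forall>s\<in>R. ev (\<lambda>x. g (gen x)) s = 0"
      using B(3) g_ev by (metis subsetD)
    then show False
      using * gv g_ev[of r] by simp
  qed
qed

lemma tens_rel_iff:
  "(r, s) \<in> tens_rel T \<longleftrightarrow> Poly_Mapping.keys r \<subseteq> fst T \<and> Poly_Mapping.keys s \<subseteq> fst T
     \<and> (\<forall>f. adm T f \<longrightarrow> ev f r = ev f s)"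
  by (simp add: tens_rel_def span_iff_functionals adm_def ev_diff)

lemma tens_rel_ev: "(r, s) \<in> tens_rel T \<Longrightarrow> adm T f \<Longrightarrow> ev f r = ev f s"
  by (simp add: tens_rel_iff)

lemma rep_in: "X \<in> tens T \<Longrightarrow> rep X \<in> X"
  unfolding rep_def
  using in_quotient_imp_non_empty[OF equiv_tens_rel] by (metis some_in_eq tens_def)

lemma keys_in_tens: "X \<in> tens T \<Longrightarrow> r \<in> X \<Longrightarrow> Poly_Mapping.keys r \<subseteq> fst T"
  using in_quotient_imp_subset[OF equiv_tens_rel] by (fastforce simp: tens_def)

text \<open>The arbitrary representative chosen by \<open>rep\<close> is invisible to an admissible
  function; this makes Sweedler sums computable from any known representative.\<close>

lemma ev_rep_cls:
  assumes "X \<in> tens T" "X = cls T r" "adm T f"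
  shows "ev f (rep X) = ev f r"
  using rep_in[OF assms(1)] tens_rel_ev[OF _ assms(3)] assms(2) by (auto simp: cls_def)

lemma cls_eqI: "(r, s) \<in> tens_rel T \<Longrightarrow> cls T r = cls T s"
  unfolding cls_def by (rule equiv_class_eq[OF equiv_tens_rel])

lemma linear_into_lin:
  assumes "linear_into sc T f" and "adm T g"
  shows "lin sc (\<lambda>v. ev g (rep (f v)))"
proof (rule linI)
  have t: "\<And>v. f v \<in> tens T" using assms(1) by (simp add: linear_into_def)
  fix v w c
  have "f (v + w) = cls T (rep (f v) + rep (f w))" and "f (sc c v) = cls T (fscale c (rep (f v)))"
    using assms(1) by (simp_all add: linear_into_def)
  then show "ev g (rep (f (v + w))) = ev g (rep (f v)) + ev g (rep (f w))"
    and "ev g (rep (f (sc c v))) = c * ev g (rep (f v))"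
    using ev_rep_cls[OF t _ assms(2)] by (simp_all add: ev_add ev_fscale)
qed

text \<open>Since \<open>F\<close> respects the relations, all members of the coset of
  \<open>G r\<close> contribute the same class and the inner union collapses. What is left is a
  union over the representatives in \<open>X\<close>, which can be compared termwise.\<close>

lemma lift_map_lift_map:
  assumes F: "\<And>r s. (r, s) \<in> tens_rel T \<Longrightarrow> (F r, F s) \<in> tens_rel T'"
    and G: "\<And>r. r \<in> X \<Longrightarrow> Poly_Mapping.keys (G r) \<subseteq> fst T"
  shows "lift_map T' F (lift_map T G X) = (\<Union>r\<in>X. cls T' (F (G r)))"
proof -
  have "(\<Union>s\<in>cls T (G r). cls T' (F s)) = cls T' (F (G r))" if "r \<in> X" for r
  proof -
    have "cls T' (F s) = cls T' (F (G r))" if "s \<in> cls T (G r)" for s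
      using that cls_eqI[OF F] by (metis Image_singleton_iff cls_def)
    moreover have "G r \<in> cls T (G r)"
      using G[OF that] by (simp add: cls_def tens_rel_iff)
    ultimately show ?thesis by blast
  qed
  then show ?thesis by (auto simp: lift_map_def)
qed

text \<open>Dual criterion: as functionals separate cosets, \<open>h\<close> descends to the
  quotients as soon as composing with \<open>h\<close> turns admissible functions on the target into
  admissible ones on the source.\<close>

lemma lext_respects:
  assumes "\<And>x. x \<in> fst T \<Longrightarrow> Poly_Mapping.keys (h x) \<subseteq> fst T'"
    and "\<And>f. adm T' f \<Longrightarrow> adm T (\<lambda>x. ev f (h x))"
    and "(r, s) \<in> tens_rel T"
  shows "(lext fscale h r, lext fscale h s) \<in> tens_rel T'"
proof -
  have "Poly_Mapping.keys r \<subseteq> fst T" "Poly_Mapping.keys s \<subseteq> fst T"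
    using assms(3) by (simp_all add: tens_rel_iff)
  then have "Poly_Mapping.keys (lext fscale h r) \<subseteq> fst T'" "Poly_Mapping.keys (lext fscale h s) \<subseteq> fst T'"
    using assms(1) by (meson keys_lext subsetD)+
  then show ?thesis
    by (auto simp: tens_rel_iff ev_lext intro: tens_rel_ev[OF assms(3)] assms(2))
qed

section \<open>Functionals applied to Sweedler sums and to relations\<close>

lemma lin_sw: "lin sc L \<Longrightarrow> L (sw sc f X) = sw (*) (\<lambda>x y. L (f x y)) X"
  and lin_swr: "lin sc L \<Longrightarrow> L (swr sc g Z) = swr (*) (\<lambda>x y. L (g x y)) Z"
  by (simp_all add: sw_def swr_def lin_lext case_prod_beta')

lemmas ev_sw = lin_sw[OF lin_ev_arg]
lemmas ev_swr = lin_swr[OF lin_ev_arg]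

lemma lin_sw_fun: "(\<And>x y. lin sc (\<lambda>v. f v x y)) \<Longrightarrow> lin sc (\<lambda>v. sw (*) (f v) X)"
  by (auto simp: sw_def intro!: lin_ev)

lemma sw_ev_swap: "sw (*) (\<lambda>x y. ev (f x y) r) X = ev (\<lambda>z. sw (*) (\<lambda>x y. f x y z) X) r"
  and swr_ev_swap: "swr (*) (\<lambda>x y. ev (g x y) r) Y = ev (\<lambda>z. swr (*) (\<lambda>x y. g x y z) Y) r"
  unfolding sw_def swr_def case_prod_beta by (rule ev_swap)+

lemma sw_sw_swap: "sw (*) (\<lambda>x y. sw (*) (f x y) Y) X = sw (*) (\<lambda>z w. sw (*) (\<lambda>x y. f x y z w) X) Y"
  unfolding sw_def by (rule ev_swap)

lemma adm_slot_rels: "(\<forall>s\<in>slot_rels sc S. ev f s = 0) \<longleftrightarrow> (\<forall>c\<in>S. lin sc (\<lambda>v. f (c v)))"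
proof -
  have "(\<forall>s\<in>slot_rels sc S. ev f s = 0) \<longleftrightarrow>
    (\<forall>c\<in>S. \<forall>v w. ev f (gen (c (v + w)) - gen (c v) - gen (c w)) = 0) \<and>
    (\<forall>c\<in>S. \<forall>l v. ev f (gen (c (sc l v)) - fscale l (gen (c v))) = 0)"
    unfolding slot_rels_def by blast
  then show ?thesis
    by (auto simp: lin_def ev_diff ev_fscale diff_diff_eq ev_add)
qed

lemma adm_bal_rels: "(\<forall>s\<in>bal_rels B. ev f s = 0) \<longleftrightarrow> (\<forall>(x, y)\<in>B. f x = f y)"
proof -
  have "(\<forall>s\<in>bal_rels B. ev f s = 0) \<longleftrightarrow> (\<forall>(x, y)\<in>B. ev f (gen x - gen y) = 0)"
    unfolding bal_rels_def by blast
  then show ?thesis by (simp add: ev_diff)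
qed

section \<open>Multilinear and balanced functions on words\<close>

definition mlin :: "('k::field \<Rightarrow> 'u::ab_group_add \<Rightarrow> 'u) \<Rightarrow> nat \<Rightarrow> ('u list \<Rightarrow> 'k) \<Rightarrow> bool" where
  "mlin sc n f \<longleftrightarrow> (\<forall>w i. length w = n \<longrightarrow> i < n \<longrightarrow> lin sc (\<lambda>v. f (w[i := v])))"

text \<open>By \<open>adm_UA_iff\<close>, these are exactly the functionals on the
  \<open>n\<close>-fold tensor power of \<open>U\<close> over \<open>A\<close>.\<close>

definition bal :: "('k::field, 'u::ring, 'a, 'z) bialgebroid_data_scheme \<Rightarrow> nat \<Rightarrow> ('u list \<Rightarrow> 'k) \<Rightarrow> bool" where
  "bal H n f \<longleftrightarrow> mlin (usc H) n f \<and>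
     (\<forall>w a i. length w = n \<longrightarrow> Suc i < n \<longrightarrow>
        f (w[i := tgt H a * w ! i]) = f (w[Suc i := src H a * w ! Suc i]))"

lemma mlin_iff_slots:
  fixes f :: "'u::ab_group_add list \<Rightarrow> 'k::field"
  shows "mlin sc n f \<longleftrightarrow> (\<forall>c\<in>slots n. lin sc (\<lambda>v. f (c v)))"
proof
  assume f: "mlin sc n f"
  show "\<forall>c\<in>slots n. lin sc (\<lambda>v. f (c v))"
  proof
    fix c :: "'u \<Rightarrow> 'u list" assume "c \<in> slots n"
    then obtain xs ys where c: "c = (\<lambda>v. xs @ v # ys)" and n: "length xs + length ys + 1 = n"
      by (auto simp: slots_def)
    have "lin sc (\<lambda>v. f ((xs @ 0 # ys)[length xs := v]))"
      using f n by (auto simp: mlin_def simp del: list_update_length)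
    then show "lin sc (\<lambda>v. f (c v))" by (simp add: c)
  qed
next
  assume f: "\<forall>c\<in>slots n. lin sc (\<lambda>v. f (c v))"
  show "mlin sc n f"
    unfolding mlin_def
  proof (intro allI impI)
    fix w :: "'u list" and i assume "length w = n" "i < n"
    then have "(\<lambda>v. w[i := v]) \<in> slots n"
      unfolding slots_def mem_Collect_eq
      by (intro exI[of _ "take i w"] exI[of _ "drop (Suc i) w"]) (auto simp: upd_conv_take_nth_drop)
    then show "lin sc (\<lambda>v. f (w[i := v]))"
      using f by blast
  qed
qed

lemma adj_iff_update:
  fixes f :: "'u list \<Rightarrow> 'k"
  shows "(\<forall>(x, y)\<in>adj n F G. f x = f y) \<longleftrightarrow>
     (\<forall>w a i. length w = n \<longrightarrow> Suc i < n \<longrightarrow> f (w[i := F a (w ! i)]) = f (w[Suc i := G a (w ! Suc i)]))"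
  (is "?L \<longleftrightarrow> ?R")
proof
  assume f: ?L
  show ?R
  proof (intro allI impI)
    fix w :: "'u list" and a i assume w: "length w = n" "Suc i < n"
    define xs ys u v where "xs = take i w" and "ys = drop (Suc (Suc i)) w"
      and "u = w ! i" and "v = w ! Suc i"
    have "w = xs @ u # v # ys"
      using w by (simp add: xs_def ys_def u_def v_def Cons_nth_drop_Suc)
    moreover have "length xs = i"
      using w by (simp add: xs_def)
    moreover have "(xs @ F a u # v # ys, xs @ u # G a v # ys) \<in> adj n F G"
      using w unfolding adj_def xs_def ys_def by fastforce
    ultimately show "f (w[i := F a (w ! i)]) = f (w[Suc i := G a (w ! Suc i)])"
      using f by (auto simp: nth_append list_update_append)
  qed
next
  assume f: ?R
  show ?L
  proof clarify
    fix x y assume "(x, y) \<in> adj n F G"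
    then obtain xs a u v ys where xy: "x = xs @ F a u # v # ys" "y = xs @ u # G a v # ys"
      and n: "length xs + length ys + 2 = n"
      by (auto simp: adj_def)
    show "f x = f y"
      using f[rule_format, of "xs @ u # v # ys" "length xs" a] n
      by (simp add: xy nth_append list_update_append)
  qed
qed

lemma adm_UA_iff: "adm (UA H n) f \<longleftrightarrow> bal H n f"
  by (simp add: adm_def UA_def tpow_def bal_A_def bal_def ball_Un adm_slot_rels adm_bal_rels
      mlin_iff_slots adj_iff_update)

lemma adm_tpow_iff: "adm (tpow sc {} n) f \<longleftrightarrow> mlin sc n f"
  by (simp add: adm_def tpow_def ball_Un adm_slot_rels adm_bal_rels mlin_iff_slots)

lemma bal_mlin: "bal H n f \<Longrightarrow> mlin (usc H) n f"
  by (simp add: bal_def)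

lemma mlin_lin: "mlin sc n f \<Longrightarrow> length w = n \<Longrightarrow> i < n \<Longrightarrow> lin sc (\<lambda>v. f (w[i := v]))"
  by (simp add: mlin_def)

lemma mlin_0 [simp]: "mlin sc 0 f"
  by (simp add: mlin_def)

lemma bal_0 [simp]: "bal H 0 f"
  by (simp add: bal_def)

lemma mlin_Suc:
  fixes f :: "'u::ab_group_add list \<Rightarrow> 'k::field"
  shows "mlin sc (Suc n) f \<longleftrightarrow>
     (\<forall>w. length w = n \<longrightarrow> lin sc (\<lambda>v. f (v # w))) \<and> (\<forall>x. mlin sc n (\<lambda>w. f (x # w)))"
  (is "?L \<longleftrightarrow> ?R")
proof
  assume f: ?L
  show ?R
  proof (intro conjI allI impI)
    fix w :: "'u list" assume "length w = n"
    then show "lin sc (\<lambda>v. f (v # w))"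
      using mlin_lin[OF f, of "0 # w" 0] by simp
  next
    fix x
    show "mlin sc n (\<lambda>w. f (x # w))"
      unfolding mlin_def using mlin_lin[OF f, of "x # _" "Suc _"] by simp
  qed
next
  assume f: ?R
  show ?L
    unfolding mlin_def
  proof (intro allI impI)
    fix w :: "'u list" and i assume w: "length w = Suc n" "i < Suc n"
    then obtain x w' where [simp]: "w = x # w'" and "length w' = n"
      by (auto simp: length_Suc_conv)
    then show "lin sc (\<lambda>v. f (w[i := v]))"
      using f w by (cases i) (auto simp: mlin_def)
  qed
qed

text \<open>Recursion on the first letter, for inductions on words: a balancing relation either sits
  between the first two letters or lies entirely in the tail.\<close>

lemma bal_Suc:
  fixes f :: "'u::ring list \<Rightarrow> 'k::field"
  shows "bal H (Suc n) f \<longleftrightarrow>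
     (\<forall>w. length w = n \<longrightarrow> lin (usc H) (\<lambda>v. f (v # w))) \<and> (\<forall>x. bal H n (\<lambda>w. f (x # w))) \<and>
     (\<forall>a u v w. Suc (length w) = n \<longrightarrow> f (tgt H a * u # v # w) = f (u # src H a * v # w))"
  (is "?L \<longleftrightarrow> ?R")
proof
  assume f: ?L
  then have b: "f (w[i := tgt H a * w ! i]) = f (w[Suc i := src H a * w ! Suc i])"
    if "length w = Suc n" "i < n" for w a i
    using that by (simp add: bal_def)
  show ?R
  proof (intro conjI allI impI)
    fix x
    show "bal H n (\<lambda>w. f (x # w))"
      unfolding bal_def using bal_mlin[OF f] b[of "x # _" "Suc _"] by (simp add: mlin_Suc)
  next
    fix a u v and w :: "'u list" assume "Suc (length w) = n"
    then show "f (tgt H a * u # v # w) = f (u # src H a * v # w)"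
      using b[of "u # v # w" 0 a] by auto
  qed (use bal_mlin[OF f] in \<open>simp add: mlin_Suc\<close>)
next
  assume f: ?R
  show ?L
    unfolding bal_def
  proof (intro conjI allI impI)
    show "mlin (usc H) (Suc n) f"
      using f by (auto simp: mlin_Suc bal_def)
    fix w :: "'u list" and a i assume w: "length w = Suc n" "Suc i < Suc n"
    then obtain x y w' where [simp]: "w = x # y # w'" and "Suc (length w') = n"
      by (cases w; cases "tl w") auto
    show "f (w[i := tgt H a * w ! i]) = f (w[Suc i := src H a * w ! Suc i])"
    proof (cases i)
      case 0
      then show ?thesis using f \<open>Suc (length w') = n\<close> by simp
    next
      case (Suc j)
      have "bal H n (\<lambda>w. f (x # w))" using f by blast
      then have "f (x # (y # w')[j := tgt H a * (y # w') ! j])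
          = f (x # (y # w')[Suc j := src H a * (y # w') ! Suc j])"
        unfolding bal_def using \<open>Suc (length w') = n\<close> w(2) Suc
        by (metis Suc_less_eq length_Cons)
      then show ?thesis using Suc by simp
    qed
  qed
qed

lemma mlin_ev:
  assumes "\<And>x. x \<in> Poly_Mapping.keys r \<Longrightarrow> mlin sc n (f x)"
  shows "mlin sc n (\<lambda>w. ev (\<lambda>x. f x w) r)"
  using assms by (auto simp: mlin_def intro!: lin_ev)

lemma bal_ev:
  assumes "\<And>x. x \<in> Poly_Mapping.keys r \<Longrightarrow> bal H n (f x)"
  shows "bal H n (\<lambda>w. ev (\<lambda>x. f x w) r)"
  using assms by (auto simp: bal_def intro!: mlin_ev ev_cong)

lemma mlin_swr: "(\<And>x y. mlin sc n (g x y)) \<Longrightarrow> mlin sc n (\<lambda>w. swr (*) (\<lambda>x y. g x y w) Y)"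
  and bal_sw: "(\<And>x y. bal H n (h x y)) \<Longrightarrow> bal H n (\<lambda>w. sw (*) (\<lambda>x y. h x y w) X)"
  and bal_swr: "(\<And>x y. bal H n (k x y)) \<Longrightarrow> bal H n (\<lambda>w. swr (*) (\<lambda>x y. k x y w) Y)"
  by (auto simp: sw_def swr_def case_prod_beta intro!: mlin_ev bal_ev)

lemma map2_update_left:
  "length w = length z \<Longrightarrow> map2 f (w[i := v]) z = (map2 f w z)[i := f v (z ! i)]"
  by (metis list_update_id zip_update map_update case_prod_conv)

lemma map2_update_right:
  "length w = length z \<Longrightarrow> map2 f w (z[i := v]) = (map2 f w z)[i := f (w ! i) v]"
  by (metis list_update_id zip_update map_update case_prod_conv)

text \<open>The last condition is the balance between the last letter and \<open>P\<close>; writing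
  \<open>n = Suc m\<close> makes it void for \<open>n = 0\<close>, where there is no last
  letter.\<close>

lemma adm_Cup_iff:
  fixes f :: "'u::ring list \<times> 'p::ab_group_add \<Rightarrow> 'k::field"
  shows "adm (Cup H P n) f \<longleftrightarrow>
     (\<forall>p. bal H n (\<lambda>w. f (w, p))) \<and>
     (\<forall>w. length w = n \<longrightarrow> lin (psc P) (\<lambda>p. f (w, p))) \<and>
     (\<forall>m w a p. n = Suc m \<longrightarrow> length w = n \<longrightarrow>
        f (w[m := tgt H a * w ! m], p) = f (w, lact P a p))"
proof -
  define E where "E = {((us @ [tgt H a * u], p), (us @ [u], lact P a p)) | p a u us. length us + 1 = n}"
  have E: "(\<forall>(x, y)\<in>E. f x = f y) \<longleftrightarrow>
    (\<forall>m w a p. n = Suc m \<longrightarrow> length w = n \<longrightarrow> f (w[m := tgt H a * w ! m], p) = f (w, lact P a p))"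
    (is "?L \<longleftrightarrow> ?R")
  proof
    assume f: ?L
    show ?R
    proof (intro allI impI)
      fix m a p and w :: "'u list" assume "n = Suc m" "length w = n"
      then obtain us u where w: "w = us @ [u]" and us: "length us = m"
        by (metis length_Suc_conv_rev)
      then have "((us @ [tgt H a * u], p), (us @ [u], lact P a p)) \<in> E"
        using \<open>n = Suc m\<close> by (auto simp: E_def)
      then show "f (w[m := tgt H a * w ! m], p) = f (w, lact P a p)"
        using f w us by (auto simp: list_update_append)
    qed
  next
    assume f: ?R
    have "f x = f y" if xy: "(x, y) \<in> E" for x y
    proof -
      obtain us u a p where "x = (us @ [tgt H a * u], p)" "y = (us @ [u], lact P a p)"
        and "length us + 1 = n"
        using xy unfolding E_def by blast
      then show ?thesis
        using f[rule_format, of "length us" "us @ [u]" a p] by (simp add: list_update_append)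
    qed
    then show ?L by blast
  qed
  have B: "(\<forall>(x, y)\<in>{((w, m), (w', m)) | m w w'. (w, w') \<in> bal_A H n}. f x = f y) \<longleftrightarrow>
    (\<forall>p. \<forall>(x, y)\<in>bal_A H n. f (x, p) = f (y, p))"
    by blast
  have S: "(\<forall>c\<in>{(\<lambda>v. (c v, m)) | m c. c \<in> slots n}. lin (usc H) (\<lambda>v. f (c v))) \<longleftrightarrow>
    (\<forall>p. mlin (usc H) n (\<lambda>w. f (w, p)))" (is "?L \<longleftrightarrow> ?R")
  proof
    assume f: ?L
    have "lin (usc H) (\<lambda>v. f (c v, p))" if "c \<in> slots n" for p c
      using bspec[OF f, of "\<lambda>v. (c v, p)"] that by blast
    then show ?R by (simp add: mlin_iff_slots)
  qed (auto simp: mlin_iff_slots)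
  have S': "(\<forall>c\<in>{(\<lambda>m. (w, m)) | w. w \<in> words n}. lin (psc P) (\<lambda>v. f (c v))) \<longleftrightarrow>
    (\<forall>w. length w = n \<longrightarrow> lin (psc P) (\<lambda>p. f (w, p)))"
    unfolding words_def by blast
  show ?thesis
    unfolding adm_def Cup_def tpow_right_def snd_conv ball_Un adm_slot_rels adm_bal_rels
      E_def[symmetric] E B S S'
    by (auto simp: bal_A_def bal_def adj_iff_update)
qed

lemma adm_ClowI:
  assumes "\<And>p. mlin (usc H) n (\<lambda>w. f (p, w))"
    and "\<And>w. length w = n \<Longrightarrow> lin (psc P) (\<lambda>p. f (p, w))"
    and "\<And>p a u us. Suc (length us) = n \<Longrightarrow> f (ract P p (tgt H a), u # us) = f (p, tgt H a * u # us)"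
    and "\<And>p w a i. length w = n \<Longrightarrow> Suc i < n \<Longrightarrow>
      f (p, w[i := w ! i * tgt H a]) = f (p, w[Suc i := tgt H a * w ! Suc i])"
  shows "adm (Clow H P n) f"
proof -
  have B: "(\<forall>(x, y)\<in>{((m, w), (m, w')) | m w w'. (w, w') \<in> bal_Aop H n}. f x = f y) \<longleftrightarrow>
    (\<forall>p. \<forall>(x, y)\<in>bal_Aop H n. f (p, x) = f (p, y))"
    by blast
  show ?thesis
    unfolding adm_def Clow_def tpow_left_def snd_conv ball_Un adm_slot_rels adm_bal_rels B
    unfolding bal_Aop_def adj_iff_update
    using assms by (auto simp: words_def mlin_iff_slots)
qed

section \<open>The Hopf-Galois map respects the relations\<close>

text \<open>The case \<open>n = 2\<close> of \<open>bal\<close>, curried as \<open>sw\<close> takes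
  its summand.\<close>

definition bal2 :: "('k::field, 'u::ring, 'a, 'z) bialgebroid_data_scheme \<Rightarrow> ('u \<Rightarrow> 'u \<Rightarrow> 'k) \<Rightarrow> bool" where
  "bal2 H g \<longleftrightarrow> (\<forall>v. lin (usc H) (\<lambda>u. g u v)) \<and> (\<forall>u. lin (usc H) (\<lambda>v. g u v)) \<and>
     (\<forall>a u v. g (tgt H a * u) v = g u (src H a * v))"

lemma bal2I:
  assumes "\<And>v. lin (usc H) (\<lambda>u. g u v)" and "\<And>u. lin (usc H) (\<lambda>v. g u v)"
    and "\<And>a u v. g (tgt H a * u) v = g u (src H a * v)"
  shows "bal2 H g"
  using assms by (simp add: bal2_def)

lemma bal2_bal: "bal2 H g \<Longrightarrow> bal H 2 (\<lambda>w. g (w ! 0) (w ! 1))"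
  by (simp add: bal2_def bal_Suc numeral_2_eq_2)

lemma bal_bal2: "bal H (Suc (Suc n)) f \<Longrightarrow> length r = n \<Longrightarrow> bal2 H (\<lambda>u v. f (u # v # r))"
  by (simp add: bal2_def bal_Suc)

lemma bal_cong: "(\<And>w. length w = n \<Longrightarrow> f w = g w) \<Longrightarrow> bal H n f \<longleftrightarrow> bal H n g"
  by (simp add: bal_def mlin_def)

text \<open>Transpose of one step of \<open>iter_cop\<close>: a function of longer words is pulled
  back along the coproduct on the first letter.\<close>

definition split_head :: "('k::field, 'u, 'a, 'z) bialgebroid_data_scheme \<Rightarrow> ('u list \<Rightarrow> 'k) \<Rightarrow> 'u list \<Rightarrow> 'k" where
  "split_head H f w = sw (*) (\<lambda>v1 v2. f (v1 # v2 # tl w)) (ucop H (hd w))"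

lemma ev_iter_cop_Suc: "ev f (iter_cop H (Suc m) u) = ev (split_head H f) (iter_cop H m u)"
  by (simp add: ev_lext ev_sw split_head_def[abs_def])

text \<open>Transpose of one step of \<open>xi_word\<close>: \<open>f\<close> is composed with
  \<open>z \<mapsto> (u1 \<otimes> ... \<otimes> un)(1 \<otimes> z)\<close>. Since
  \<open>iter_cop H m\<close> has \<open>m + 1\<close> factors, the length of \<open>z\<close> is
  the right index for the word \<open>1 # z\<close>.\<close>

definition lmul :: "('k::field, 'u::{ring, monoid_mult}, 'a, 'z) bialgebroid_data_scheme
    \<Rightarrow> 'u \<Rightarrow> ('u list \<Rightarrow> 'k) \<Rightarrow> 'u list \<Rightarrow> 'k" where
  "lmul H u f z = ev (\<lambda>w. f (map2 (*) w (1 # z))) (iter_cop H (length z) u)"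

lemma keys_iter_cop: "Poly_Mapping.keys (iter_cop H m u) \<subseteq> words (Suc m)"
proof (induction m)
  case (Suc m)
  then show ?case
    unfolding iter_cop.simps sw_def by (intro keys_lext) (auto simp: words_def)
qed (simp add: words_def)

lemma length_iter_cop: "w \<in> Poly_Mapping.keys (iter_cop H m u) \<Longrightarrow> length w = Suc m"
  using keys_iter_cop[of H m u] by (auto simp: words_def)

lemma keys_xi_word: "Poly_Mapping.keys (xi_word H us) \<subseteq> words (length us)"
proof (induction us)
  case (Cons u us)
  then show ?case
    unfolding xi_word.simps
    by (intro keys_lext) (auto simp: words_def subset_iff dest: length_iter_cop)
qed (simp add: words_def)

lemma length_xi_word: "w \<in> Poly_Mapping.keys (xi_word H us) \<Longrightarrow> length w = length us"
  using keys_xi_word[of H us] by (auto simp: words_def)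

lemma ev_xi_word_Cons: "ev f (xi_word H (u # us)) = ev (lmul H u f) (xi_word H us)"
proof -
  have "ev f (xi_word H (u # us)) =
      ev (\<lambda>z. ev (\<lambda>w. f (map2 (*) w (1 # z))) (iter_cop H (length us) u)) (xi_word H us)"
    by (simp add: ev_lext del: map2_map_map) (rule ev_swap)
  also have "\<dots> = ev (lmul H u f) (xi_word H us)"
    by (rule ev_cong) (simp add: lmul_def length_xi_word)
  finally show ?thesis .
qed

section \<open>Coproducts and multiplication by source and target elements\<close>

context left_bialgebroid
begin

lemma ucop_tens: "ucop H u \<in> tens (UA H 2)"
  using ucop_linear by (simp add: linear_into_def)

lemma sw_ucop_cls:
  assumes "ucop H u = cls (UA H 2) r" and "bal2 H g"
  shows "sw (*) g (ucop H u) = ev (\<lambda>w. g (w ! 0) (w ! 1)) r"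
  unfolding sw_def using ev_rep_cls[OF ucop_tens assms(1)] bal2_bal[OF assms(2)]
  by (simp add: adm_UA_iff)

lemma lin_sw_ucop: "bal2 H g \<Longrightarrow> lin (usc H) (\<lambda>u. sw (*) g (ucop H u))"
  unfolding sw_def
  by (rule linear_into_lin[OF ucop_linear adm_UA_iff[THEN iffD2, OF bal2_bal]])

lemma lin_mult_left: "lin (usc H) f \<Longrightarrow> lin (usc H) (\<lambda>v. f (z * v))"
  and lin_mult_right: "lin (usc H) f \<Longrightarrow> lin (usc H) (\<lambda>v. f (v * z))"
  by (simp_all add: lin_def distrib_left distrib_right
      U.scale_mult_left[symmetric] U.scale_mult_right[symmetric])

lemma sw_ucop_takeuchi:
  assumes "bal2 H g"
  shows "sw (*) (\<lambda>x y. g (x * tgt H a) y) (ucop H u) = sw (*) (\<lambda>x y. g x (y * src H a)) (ucop H u)"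
  using tens_rel_ev[OF ucop_takeuchi] bal2_bal[OF assms] by (fastforce simp: adm_UA_iff ev_sw)

lemma sw_ucop_tgt_left:
  assumes "bal2 H g"
  shows "sw (*) g (ucop H (tgt H a * u)) = sw (*) (\<lambda>x y. g x (tgt H a * y)) (ucop H u)"
  using sw_ucop_cls[OF ucop_bimodule assms, of 1 a u] by (simp add: src_one ev_sw)

text \<open>Multiplicativity gives \<open>\<Delta>(u t(a)) = \<Delta>(u) \<Delta>(t(a))\<close>, and
  \<open>\<Delta>(t(a)) = 1 \<otimes> t(a)\<close> by the bimodule property applied to
  \<open>t(a) 1\<close>.\<close>

lemma sw_ucop_tgt_right:
  assumes g: "bal2 H g"
  shows "sw (*) g (ucop H (u * tgt H a)) = sw (*) (\<lambda>x y. g x (y * tgt H a)) (ucop H u)"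
proof -
  \<comment> \<open>\<open>G\<close> evaluates \<open>g\<close> on the product of
    \<open>\<Delta>(u)\<close> with \<open>v1 \<otimes> v2\<close>. It is balanced in
    \<open>v1, v2\<close> by the Takeuchi condition on \<open>\<Delta>(u)\<close>.\<close>
  define G where "G = (\<lambda>v1 v2. sw (*) (\<lambda>u1 u2. g (u1 * v1) (u2 * v2)) (ucop H u))"
  have *: "bal2 H (\<lambda>u1 u2. g (u1 * v1) (u2 * v2))" for v1 v2
    using g by (auto simp: bal2_def mult.assoc intro: lin_mult_right)
  have G: "bal2 H G"
  proof (rule bal2I)
    fix b v1 v2
    show "G (tgt H b * v1) v2 = G v1 (src H b * v2)"
      using sw_ucop_takeuchi[OF *] by (simp add: G_def mult.assoc)
  qed (use g in \<open>auto simp: G_def bal2_def intro!: lin_sw_fun lin_mult_left\<close>)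
  have "sw (*) g (ucop H (u * tgt H a)) = sw (*) G (ucop H (tgt H a))"
    using sw_ucop_cls[OF ucop_mult g] unfolding G_def
    by (simp add: ev_sw) (rule sw_sw_swap)
  also have "\<dots> = sw (*) (\<lambda>x y. G x (tgt H a * y)) (ucop H 1)"
    using sw_ucop_tgt_left[OF G, of a 1] by simp
  \<comment> \<open>Replacing \<open>\<Delta>(1)\<close> by \<open>1 \<otimes> 1\<close> requires a
    balanced summand, which holds because \<open>s(b)\<close> commutes with
    \<open>t(a)\<close>.\<close>
  also have "\<dots> = G 1 (tgt H a * 1)"
    using sw_ucop_cls[OF ucop_one, of "\<lambda>x y. G x (tgt H a * y)"] G
    by (auto simp: bal2_def lin_mult_left mult.assoc[symmetric] src_tgt_commute[symmetric])
  finally show ?thesis by (simp add: G_def)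
qed

text \<open>Between the first two letters, \<open>\<Delta>(t(a) u) = u1 \<otimes> t(a) u2\<close>
  puts \<open>t(a)\<close> next to the following letter, where the balance of \<open>f\<close>
  applies.\<close>

lemma bal_split_head:
  assumes "bal H (Suc (Suc m)) f"
  shows "bal H (Suc m) (split_head H f)"
  unfolding bal_Suc
proof (intro conjI allI impI)
  fix w :: "'u list" assume "length w = m"
  then show "lin (usc H) (\<lambda>v. split_head H f (v # w))"
    using lin_sw_ucop[OF bal_bal2[OF assms]] by (simp add: split_head_def)
next
  fix x
  have "bal H m (\<lambda>w. f (v1 # v2 # w))" for v1 v2
    using assms by (simp add: bal_Suc)
  then show "bal H m (\<lambda>w. split_head H f (x # w))"
    by (auto simp: split_head_def intro: bal_sw)
next
  fix a u v and w :: "'u list" assume w: "Suc (length w) = m"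
  then have "bal2 H (\<lambda>v1 v2. f (v1 # v2 # v # w))"
    by (auto intro: bal_bal2[OF assms])
  moreover have "f (v1 # tgt H a * v2 # v # w) = f (v1 # v2 # src H a * v # w)" for v1 v2
    using assms w by (auto simp: bal_Suc)
  ultimately show "split_head H f (tgt H a * u # v # w) = split_head H f (u # src H a * v # w)"
    by (simp add: split_head_def sw_ucop_tgt_left)
qed

lemma lin_iter_cop: "bal H (Suc m) f \<Longrightarrow> lin (usc H) (\<lambda>u. ev f (iter_cop H m u))"
proof (induction m arbitrary: f)
  case 0
  then show ?case by (simp add: bal_Suc)
next
  case (Suc m)
  then show ?case unfolding ev_iter_cop_Suc by (blast intro: bal_split_head)
qed

text \<open>The first split passes \<open>t(a)\<close> to the right factor, and further splits of
  the first letter leave it there; so it ends at the last letter, which has index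
  \<open>m\<close>.\<close>

lemma iter_cop_tgt_left:
  "bal H (Suc m) f \<Longrightarrow>
    ev f (iter_cop H m (tgt H a * u)) = ev (\<lambda>w. f (w[m := tgt H a * w ! m])) (iter_cop H m u)"
proof (induction m arbitrary: f)
  case (Suc m)
  have "split_head H f (w[m := tgt H a * w ! m]) = split_head H (\<lambda>w. f (w[Suc m := tgt H a * w ! Suc m])) w"
    if w: "length w = Suc m" for w
  proof (cases m)
    case 0
    then show ?thesis
      using w sw_ucop_tgt_left[OF bal_bal2[OF Suc.prems, of "[]"]]
      by (auto simp: split_head_def length_Suc_conv)
  next
    case (Suc k)
    then show ?thesis using w by (auto simp: split_head_def length_Suc_conv)
  qed
  then show ?case
    unfolding ev_iter_cop_Suc Suc.IH[OF bal_split_head[OF Suc.prems]]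
    by (auto intro: ev_cong dest: length_iter_cop)
qed simp

text \<open>Splitting the head raises every later index by one, and \<open>t(a)\<close> on the right
  of the head itself goes to the second factor, again one index higher.\<close>

lemma split_head_tgt_right:
  assumes f: "bal H (Suc (Suc m)) f" and w: "length w = Suc m" and i: "i < Suc m"
  shows "split_head H f (w[i := w ! i * tgt H a])
    = split_head H (\<lambda>w. f (w[Suc i := w ! Suc i * tgt H a])) w"
proof (cases i)
  case 0
  then show ?thesis
    using w sw_ucop_tgt_right[OF bal_bal2[OF f, of "tl w"]]
    by (auto simp: split_head_def length_Suc_conv)
next
  case (Suc k)
  then show ?thesis using w i by (auto simp: split_head_def length_Suc_conv)
qed

lemma iter_cop_tgt_right:
  "bal H (Suc m) f \<Longrightarrow>
    ev f (iter_cop H m (u * tgt H a)) = ev (\<lambda>w. f (w[m := w ! m * tgt H a])) (iter_cop H m u)"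
proof (induction m arbitrary: f)
  case (Suc m)
  show ?case
    unfolding ev_iter_cop_Suc Suc.IH[OF bal_split_head[OF Suc.prems]]
    by (rule ev_cong) (auto dest: length_iter_cop intro: split_head_tgt_right[OF Suc.prems])
qed simp

text \<open>The last split produces letters 0 and 1, where the Takeuchi condition for
  \<open>\<Delta>\<close> applies; a pair further right comes from the pair one index lower before
  that split.\<close>

lemma iter_cop_takeuchi:
  "bal H (Suc m) f \<Longrightarrow> i < m \<Longrightarrow>
    ev (\<lambda>w. f (w[i := w ! i * tgt H a])) (iter_cop H m u)
    = ev (\<lambda>w. f (w[Suc i := w ! Suc i * src H a])) (iter_cop H m u)"
proof (induction m arbitrary: f i)
  case (Suc m)
  show ?case
  proof (cases i)
    case 0
    have "split_head H (\<lambda>w. f (w[0 := w ! 0 * tgt H a])) w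
        = split_head H (\<lambda>w. f (w[Suc 0 := w ! Suc 0 * src H a])) w" if "length w = Suc m" for w
      using that sw_ucop_takeuchi[OF bal_bal2[OF Suc.prems(1), of "tl w"]]
      by (simp add: split_head_def)
    then show ?thesis
      unfolding ev_iter_cop_Suc 0 by (auto intro: ev_cong dest: length_iter_cop)
  next
    case (Suc j)
    then have j: "j < m" using Suc.prems by simp
    have "ev (split_head H (\<lambda>w. f (w[i := w ! i * tgt H a]))) (iter_cop H m u)
        = ev (\<lambda>w. split_head H f (w[j := w ! j * tgt H a])) (iter_cop H m u)"
      unfolding Suc using j split_head_tgt_right[OF Suc.prems(1)]
      by (auto intro!: ev_cong dest!: length_iter_cop)
    also have "\<dots> = ev (\<lambda>w. split_head H f (w[Suc j := w ! Suc j * src H a])) (iter_cop H m u)"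
      by (rule Suc.IH[OF bal_split_head[OF Suc.prems(1)] j])
    also have "\<dots> = ev (split_head H (\<lambda>w. f (w[Suc i := w ! Suc i * src H a]))) (iter_cop H m u)"
      unfolding Suc using j
      by (intro ev_cong) (auto dest!: length_iter_cop simp: length_Suc_conv split_head_def)
    finally show ?thesis unfolding ev_iter_cop_Suc .
  qed
qed simp

text \<open>The elements \<open>s(a)\<close> and \<open>t(a)\<close> in the relations multiply from
  the left, so right multiplication by a fixed word does not disturb them.\<close>

lemma bal_mult_right:
  assumes "bal H n f" "length z = n"
  shows "bal H n (\<lambda>w. f (map2 (*) w z))"
  unfolding bal_def
proof (intro conjI allI impI)
  show "mlin (usc H) n (\<lambda>w. f (map2 (*) w z))"
    using assms unfolding bal_def mlin_def
    by (auto simp: map2_update_left intro!: lin_mult_right)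
  fix w :: "'u list" and a i assume w: "length w = n" "Suc i < n"
  then have "f ((map2 (*) w z)[i := tgt H a * map2 (*) w z ! i])
      = f ((map2 (*) w z)[Suc i := src H a * map2 (*) w z ! Suc i])"
    using assms(2) by (intro assms(1)[unfolded bal_def, THEN conjunct2, rule_format]) simp_all
  then show "f (map2 (*) (w[i := tgt H a * w ! i]) z) = f (map2 (*) (w[Suc i := src H a * w ! Suc i]) z)"
    using w assms(2) by (simp add: map2_update_left mult.assoc)
qed

lemma mlin_mult_left:
  assumes "mlin (usc H) n f" "length w = n"
  shows "mlin (usc H) n (\<lambda>z. f (map2 (*) w z))"
  using assms unfolding mlin_def by (auto simp: map2_update_right intro!: lin_mult_left)

text \<open>An element \<open>t(a)\<close> on a letter of \<open>z\<close> is absorbed into the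
  right side of the coproduct factor before it; the iterated Takeuchi condition turns it into
  \<open>s(a)\<close> on the next factor, which is then released onto the next letter of
  \<open>z\<close>.\<close>

lemma bal_lmul:
  assumes f: "bal H (Suc m) f"
  shows "bal H m (lmul H u f)"
proof -
  \<comment> \<open>This is \<open>lmul\<close> with the index of the iterated coproduct frozen at
    \<open>m\<close>, so that the formal sum no longer varies with \<open>z\<close>; the two agree
    on words of length \<open>m\<close>.\<close>
  define G where "G z = ev (\<lambda>w. f (map2 (*) w (1 # z))) (iter_cop H m u)" for z
  have "mlin (usc H) m (\<lambda>z. f (map2 (*) w (1 # z)))" if "length w = Suc m" for w
    using mlin_mult_left[OF bal_mlin[OF f] that] unfolding mlin_Suc by blast
  then have "mlin (usc H) m G"
    unfolding G_def by (auto intro!: mlin_ev dest: length_iter_cop)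
  moreover have "G (z[i := tgt H a * z ! i]) = G (z[Suc i := src H a * z ! Suc i])"
    if z: "length z = m" "Suc i < m" for z a i
  proof -
    have b: "bal H (Suc m) (\<lambda>w. f (map2 (*) w (1 # z)))"
      using z by (intro bal_mult_right[OF f]) simp
    \<comment> \<open>The leading 1 shifts indices: letter \<open>i\<close> of \<open>z\<close>
      faces letter \<open>Suc i\<close> of \<open>w\<close>.\<close>
    have "G (z[i := tgt H a * z ! i])
        = ev (\<lambda>w. f (map2 (*) (w[Suc i := w ! Suc i * tgt H a]) (1 # z))) (iter_cop H m u)"
      unfolding G_def
    proof (rule ev_cong)
      fix w assume "w \<in> Poly_Mapping.keys (iter_cop H m u)"
      then have "length w = length (1 # z)" using z by (simp add: length_iter_cop)
      from map2_update_left[OF this, of "(*)" "Suc i"] map2_update_right[OF this, of "(*)" "Suc i"]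
      show "f (map2 (*) w (1 # z[i := tgt H a * z ! i]))
          = f (map2 (*) (w[Suc i := w ! Suc i * tgt H a]) (1 # z))"
        by (simp add: mult.assoc)
    qed
    also have "\<dots> = ev (\<lambda>w. f (map2 (*) (w[Suc (Suc i) := w ! Suc (Suc i) * src H a]) (1 # z))) (iter_cop H m u)"
      using iter_cop_takeuchi[OF b z(2)] .
    also have "\<dots> = G (z[Suc i := src H a * z ! Suc i])"
      unfolding G_def
    proof (rule ev_cong)
      fix w assume "w \<in> Poly_Mapping.keys (iter_cop H m u)"
      then have "length w = length (1 # z)" using z by (simp add: length_iter_cop)
      from map2_update_left[OF this, of "(*)" "Suc (Suc i)"] map2_update_right[OF this, of "(*)" "Suc (Suc i)"]
      show "f (map2 (*) (w[Suc (Suc i) := w ! Suc (Suc i) * src H a]) (1 # z))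
          = f (map2 (*) w (1 # z[Suc i := src H a * z ! Suc i]))"
        by (simp add: mult.assoc)
    qed
    finally show ?thesis .
  qed
  ultimately have "bal H m G" by (simp add: bal_def)
  then show ?thesis
    by (subst bal_cong[of m _ G]) (simp_all add: lmul_def G_def)
qed

section \<open>The Hopf-Galois word and the relations over \<open>A^op\<close>\<close>

lemma mlin_xi_word: "bal H n f \<Longrightarrow> mlin (usc H) n (\<lambda>us. ev f (xi_word H us))"
proof (induction n arbitrary: f)
  case (Suc n)
  show ?case
    unfolding mlin_Suc ev_xi_word_Cons
  proof (intro conjI allI impI)
    fix w :: "'u list" assume w: "length w = n"
    have "lin (usc H) (\<lambda>v. lmul H v f z)" if "length z = n" for z
      unfolding lmul_def using that Suc.prems by (intro lin_iter_cop bal_mult_right) simp_all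
    then show "lin (usc H) (\<lambda>v. ev (lmul H v f) (xi_word H w))"
      using w by (auto intro!: lin_ev dest: length_xi_word)
  qed (rule Suc.IH[OF bal_lmul[OF Suc.prems]])
qed simp

text \<open>The iterated coproduct of the first letter carries \<open>t(a)\<close> to its last
  factor, which is leftmost in the last letter of the word. That letter is the one to which
  \<open>\<xi>\<close> attaches \<open>P\<close>.\<close>

lemma xi_word_tgt_first:
  assumes f: "bal H (Suc (length us)) f"
  shows "ev f (xi_word H (tgt H a * u # us))
    = ev (\<lambda>w. f (w[length us := tgt H a * w ! length us])) (xi_word H (u # us))"
  unfolding ev_xi_word_Cons
proof (rule ev_cong)
  fix z assume "z \<in> Poly_Mapping.keys (xi_word H us)"
  then have z: "length z = length us" by (rule length_xi_word)
  have "lmul H (tgt H a * u) f z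
      = ev (\<lambda>w. f (map2 (*) (w[length us := tgt H a * w ! length us]) (1 # z))) (iter_cop H (length us) u)"
    unfolding lmul_def z using z by (intro iter_cop_tgt_left bal_mult_right[OF f]) simp
  also have "\<dots> = lmul H u (\<lambda>w. f (w[length us := tgt H a * w ! length us])) z"
    unfolding lmul_def z
    by (rule ev_cong) (auto simp: map2_update_left z mult.assoc dest: length_iter_cop)
  finally show "lmul H (tgt H a * u) f z = lmul H u (\<lambda>w. f (w[length us := tgt H a * w ! length us])) z" .
qed

text \<open>For the first pair, \<open>t(a)\<close> on the right of \<open>u\<close> reaches the
  right side of the last coproduct factor, hence the left of the last letter of the remaining word;
  by \<open>xi_word_tgt_first\<close> this is also the effect of \<open>t(a)\<close> on the left of
  the second letter. Later pairs lie in the tail.\<close>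

lemma xi_word_tgt_inner:
  "bal H (length us) f \<Longrightarrow> Suc i < length us \<Longrightarrow>
    ev f (xi_word H (us[i := us ! i * tgt H a])) = ev f (xi_word H (us[Suc i := tgt H a * us ! Suc i]))"
proof (induction us arbitrary: f i)
  case (Cons u us)
  have b: "bal H (length us) (lmul H u f)"
    using Cons.prems by (auto intro: bal_lmul)
  show ?case
  proof (cases i)
    case (Suc j)
    then show ?thesis
      using Cons.IH[OF b, of j] Cons.prems(2) by (simp add: ev_xi_word_Cons del: xi_word.simps)
  next
    case 0
    then obtain v vs where us: "us = v # vs" using Cons.prems(2) by (cases us) auto
    \<comment> \<open>The last index is \<open>k\<close> in the word of the remaining letters and
      \<open>Suc k\<close> in the coproduct of \<open>u\<close>.\<close>
    define k where "k = length vs"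
    have "ev f (xi_word H (u * tgt H a # us))
        = ev (\<lambda>z. lmul H u f (z[k := tgt H a * z ! k])) (xi_word H us)"
      unfolding ev_xi_word_Cons
    proof (rule ev_cong)
      fix z assume "z \<in> Poly_Mapping.keys (xi_word H us)"
      then have "length z = length us" by (rule length_xi_word)
      then have z: "length z = Suc k" by (simp add: us k_def)
      have "lmul H (u * tgt H a) f z
          = ev (\<lambda>w. f (map2 (*) (w[Suc k := w ! Suc k * tgt H a]) (1 # z))) (iter_cop H (Suc k) u)"
        unfolding lmul_def z using z Cons.prems
        by (intro iter_cop_tgt_right bal_mult_right) (simp_all add: us k_def)
      also have "\<dots> = lmul H u f (z[k := tgt H a * z ! k])"
        unfolding lmul_def length_list_update z
      proof (rule ev_cong)
        fix w assume "w \<in> Poly_Mapping.keys (iter_cop H (Suc k) u)"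
        then have "length w = length (1 # z)" using z by (simp add: length_iter_cop)
        from map2_update_left[OF this, of "(*)" "Suc k"] map2_update_right[OF this, of "(*)" "Suc k"]
        show "f (map2 (*) (w[Suc k := w ! Suc k * tgt H a]) (1 # z))
            = f (map2 (*) w (1 # z[k := tgt H a * z ! k]))"
          by (simp add: mult.assoc)
      qed
      finally show "lmul H (u * tgt H a) f z = lmul H u f (z[k := tgt H a * z ! k])" .
    qed
    also have "\<dots> = ev (lmul H u f) (xi_word H (tgt H a * v # vs))"
      using xi_word_tgt_first[of vs "lmul H u f" a v] b by (simp add: us k_def)
    finally show ?thesis
      by (simp add: 0 us ev_xi_word_Cons del: xi_word.simps)
  qed
qed simp

end

text \<open>With 1 as the source argument, the SAYD formula for the action of
  \<open>s(1) t(a)\<close> becomes \<open>a\<close> applied to the counit sum of the coaction, and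
  that sum is \<open>p\<close>.\<close>

lemma (in sayd_module) ract_tgt: "ract P p (tgt H a) = lact P a p"
proof -
  interpret l: Vector_Spaces.linear "psc P" "psc P" "lact P a"
    by (rule lact_linear)
  have "ract P p (tgt H a) = swl (psc P) (\<lambda>v q. lact P a (lact P (ucou H v) q)) (pcoact P p)"
    using ract_src_tgt[of p 1 a] by (simp add: src_one lact_mult)
  also have "\<dots> = lact P a (swl (psc P) (\<lambda>v q. lact P (ucou H v) q) (pcoact P p))"
    unfolding swl_def lext_def by (simp add: l.sum l.scale case_prod_beta)
  finally show ?thesis by (simp add: pcoact_counit)
qed

text \<open>Through \<open>lext_respects\<close> this is the well-definedness of
  \<open>\<xi>\<close>. The relation joining \<open>P\<close> to the first letter is carried to the
  one joining the last letter to \<open>P\<close>; they match because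
  \<open>p t(a) = a p\<close>.\<close>

lemma (in sayd_module) adm_xi:
  assumes "adm (Cup H P n) f"
  shows "adm (Clow H P n) (\<lambda>(p, us). ev (\<lambda>w. f (w, p)) (xi_word H us))"
proof (rule adm_ClowI)
  have b: "bal H n (\<lambda>w. f (w, p))" for p
    using assms by (simp add: adm_Cup_iff)
  show "mlin (usc H) n (\<lambda>w. case (p, w) of (p, us) \<Rightarrow> ev (\<lambda>w. f (w, p)) (xi_word H us))" for p
    using mlin_xi_word[OF b] by simp
  show "lin (psc P) (\<lambda>p. case (p, w) of (p, us) \<Rightarrow> ev (\<lambda>w. f (w, p)) (xi_word H us))"
    if "length w = n" for w
    using assms that by (auto simp: adm_Cup_iff length_xi_word intro!: lin_ev)
  show "(case (p, w[i := w ! i * tgt H a]) of (p, us) \<Rightarrow> ev (\<lambda>w. f (w, p)) (xi_word H us)) =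
      (case (p, w[Suc i := tgt H a * w ! Suc i]) of (p, us) \<Rightarrow> ev (\<lambda>w. f (w, p)) (xi_word H us))"
    if "length w = n" "Suc i < n" for p w a i
    using xi_word_tgt_inner[of w "\<lambda>w. f (w, p)" i a] b[of p] that by simp
  show "(case (ract P p (tgt H a), u # us) of (p, us) \<Rightarrow> ev (\<lambda>w. f (w, p)) (xi_word H us)) =
      (case (p, tgt H a * u # us) of (p, us) \<Rightarrow> ev (\<lambda>w. f (w, p)) (xi_word H us))"
    if "Suc (length us) = n" for p a u us
  proof -
    have "f (w, lact P a p) = f (w[length us := tgt H a * w ! length us], p)" if "length w = n" for w
      using assms that \<open>Suc (length us) = n\<close> unfolding adm_Cup_iff by metis
    then have "ev (\<lambda>w. f (w, lact P a p)) (xi_word H (u # us))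
        = ev (\<lambda>w. f (w[length us := tgt H a * w ! length us], p)) (xi_word H (u # us))"
      using \<open>Suc (length us) = n\<close> by (intro ev_cong) (auto dest: length_xi_word simp del: xi_word.simps)
    also have "\<dots> = ev (\<lambda>w. f (w, p)) (xi_word H (tgt H a * u # us))"
      using xi_word_tgt_first[of us "\<lambda>w. f (w, p)" a u] b[of p] that by simp
    finally show ?thesis by (simp add: ract_tgt del: xi_word.simps)
  qed
qed

section \<open>Iterated coproducts and coactions\<close>

definition bilin :: "('k::field \<Rightarrow> 'v::ab_group_add \<Rightarrow> 'v) \<Rightarrow> ('k \<Rightarrow> 'w::ab_group_add \<Rightarrow> 'w)
    \<Rightarrow> ('v \<Rightarrow> 'w \<Rightarrow> 'k) \<Rightarrow> bool" where
  "bilin sc sc' g \<longleftrightarrow> (\<forall>y. lin sc (\<lambda>x. g x y)) \<and> (\<forall>x. lin sc' (g x))"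

lemma bilinI:
  assumes "\<And>y. lin sc (\<lambda>x. g x y)" and "\<And>x. lin sc' (g x)"
  shows "bilin sc sc' g"
  using assms by (simp add: bilin_def)

text \<open>The words have \<open>n\<close> letters, not \<open>n + 1\<close>: the empty word
  carries the counit, matching an iterated coaction without factors in \<open>C\<close>. New letters
  are put in front, as in \<open>iter_coact\<close>.\<close>

fun iter_cc :: "('k::field, 'c) coalgebra_data \<Rightarrow> nat \<Rightarrow> 'c \<Rightarrow> ('c list \<Rightarrow>\<^sub>0 'k)" where
  "iter_cc C 0 x = Poly_Mapping.single [] (ccou C x)"
| "iter_cc C (Suc n) x =
     sw fscale (\<lambda>x1 x2. lext fscale (\<lambda>w. gen (x1 # w)) (iter_cc C n x2)) (ccop C x)"

lemma ev_iter_cc_Suc: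
  "ev F (iter_cc C (Suc n) x) = sw (*) (\<lambda>x1 x2. ev (\<lambda>w. F (x1 # w)) (iter_cc C n x2)) (ccop C x)"
  by (simp add: ev_sw ev_lext)

lemma length_iter_cc: "w \<in> Poly_Mapping.keys (iter_cc C n x) \<Longrightarrow> length w = n"
proof -
  have "Poly_Mapping.keys (iter_cc C n x) \<subseteq> words n"
  proof (induction n arbitrary: x)
    case (Suc n)
    then show ?case
      unfolding iter_cc.simps sw_def
      by (intro keys_lext) (fastforce simp: words_def)
  qed (simp add: words_def)
  then show "w \<in> Poly_Mapping.keys (iter_cc C n x) \<Longrightarrow> length w = n"
    by (auto simp: words_def)
qed

section \<open>The coalgebra axioms on multilinear test functions\<close>

context coalgebra
begin

lemma sw_ccop_eq: "sw (*) g (ccop C x) = ev (\<lambda>w. g (w ! 0) (w ! 1)) (rep (ccop C x))"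
  by (simp add: sw_def)

lemma adm_bilin: "bilin (csc C) (csc C) g \<Longrightarrow> adm (tpow (csc C) {} 2) (\<lambda>w. g (w ! 0) (w ! 1))"
  unfolding adm_tpow_iff numeral_2_eq_2 by (simp add: bilin_def mlin_Suc)

lemma lin_sw_ccop: "bilin (csc C) (csc C) g \<Longrightarrow> lin (csc C) (\<lambda>x. sw (*) g (ccop C x))"
  unfolding sw_def by (rule linear_into_lin[OF cop_linear adm_bilin])

lemma sw_coassoc:
  assumes "\<And>b c. lin (csc C) (\<lambda>a. h a b c)" "\<And>a c. lin (csc C) (\<lambda>b. h a b c)"
    "\<And>a b. lin (csc C) (\<lambda>c. h a b c)"
  shows "sw (*) (\<lambda>x y. sw (*) (\<lambda>x' x''. h x' x'' y) (ccop C x)) (ccop C z) =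
    sw (*) (\<lambda>x y. sw (*) (\<lambda>y' y''. h x y' y'') (ccop C y)) (ccop C z)"
proof -
  have "adm (tpow (csc C) {} 3) (\<lambda>w. h (w ! 0) (w ! 1) (w ! 2))"
    using assms by (simp add: adm_tpow_iff numeral_3_eq_3 mlin_Suc)
  from tens_rel_ev[OF coassoc this] show ?thesis
    by (simp add: ev_sw)
qed

lemma sw_counit_right: "lin (csc C) f \<Longrightarrow> sw (*) (\<lambda>x y. ccou C y * f x) (ccop C z) = f z"
  using lin_sw[of "csc C" f "\<lambda>x y. csc C (ccou C y) x" "ccop C z"]
  by (simp add: counit_right lin_scale)

lemma sw_counit_left: "lin (csc C) f \<Longrightarrow> sw (*) (\<lambda>x y. ccou C x * f y) (ccop C z) = f z"
  using lin_sw[of "csc C" f "\<lambda>x y. csc C (ccou C x) y" "ccop C z"]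
  by (simp add: counit_left lin_scale)

lemma lin_ccou: "lin (csc C) (ccou C)"
  by (rule lin_linear[OF cou_linear])

lemma lin_iter_cc: "mlin (csc C) n F \<Longrightarrow> lin (csc C) (\<lambda>x. ev F (iter_cc C n x))"
proof (induction n arbitrary: F)
  case 0
  then show ?case by (simp add: lin_mult_right[OF lin_ccou])
next
  case (Suc n)
  then have "bilin (csc C) (csc C) (\<lambda>x1 x2. ev (\<lambda>w. F (x1 # w)) (iter_cc C n x2))"
    by (auto simp: mlin_Suc intro!: bilinI lin_ev dest: length_iter_cc)
  then show ?case unfolding ev_iter_cc_Suc by (rule lin_sw_ccop)
qed

end

section \<open>Permuting coproduct factors by cocommutativity\<close>

context cocommutative_coalgebra
begin

lemma sw_commute:
  assumes "bilin (csc C) (csc C) g"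
  shows "sw (*) g (ccop C x) = sw (*) (\<lambda>a b. g b a) (ccop C x)"
proof -
  have "ccop C x \<in> tens (tpow (csc C) {} 2)"
    using cop_linear by (simp add: linear_into_def)
  from ev_rep_cls[OF this cocommutative adm_bilin[OF assms]]
  show ?thesis unfolding sw_ccop_eq[symmetric] by (simp add: ev_sw)
qed

lemma sw_left_commute:
  assumes h: "\<And>b c. lin (csc C) (\<lambda>a. h a b c)" "\<And>a c. lin (csc C) (\<lambda>b. h a b c)"
    "\<And>a b. lin (csc C) (\<lambda>c. h a b c)"
  shows "sw (*) (\<lambda>a y. sw (*) (\<lambda>b c. h a b c) (ccop C y)) (ccop C x) =
    sw (*) (\<lambda>a y. sw (*) (\<lambda>b c. h b a c) (ccop C y)) (ccop C x)"
proof -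
  have "bilin (csc C) (csc C) (\<lambda>a b. h a b c)" for c
    by (rule bilinI) (rule h)+
  from sw_commute[OF this]
  show ?thesis
    by (simp add: sw_coassoc[symmetric] h)
qed

text \<open>Bringing both sides into right-nested form leaves a swap of the middle two of four
  factors. This expresses that the coproduct of a cocommutative coalgebra is itself a coalgebra
  map.\<close>

lemma sw_exchange:
  assumes h: "\<And>b c d. lin (csc C) (\<lambda>a. h a b c d)" "\<And>a c d. lin (csc C) (\<lambda>b. h a b c d)"
    "\<And>a b d. lin (csc C) (\<lambda>c. h a b c d)" "\<And>a b c. lin (csc C) (\<lambda>d. h a b c d)"
  shows "sw (*) (\<lambda>x1 x2. sw (*) (\<lambda>a b. sw (*) (\<lambda>c d. h a b c d) (ccop C x2)) (ccop C x1)) (ccop C x) =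
    sw (*) (\<lambda>x1 x2. sw (*) (\<lambda>a c. sw (*) (\<lambda>b d. h a b c d) (ccop C x2)) (ccop C x1)) (ccop C x)"
proof -
  have "sw (*) (\<lambda>x1 x2. sw (*) (\<lambda>a b. sw (*) (\<lambda>c d. h a b c d) (ccop C x2)) (ccop C x1)) (ccop C x)
      = sw (*) (\<lambda>a y. sw (*) (\<lambda>b x2. sw (*) (\<lambda>c d. h a b c d) (ccop C x2)) (ccop C y)) (ccop C x)"
    by (rule sw_coassoc) (auto intro!: lin_sw_fun lin_sw_ccop bilinI h)
  also have "\<dots> = sw (*) (\<lambda>a y. sw (*) (\<lambda>c x2. sw (*) (\<lambda>b d. h a b c d) (ccop C x2)) (ccop C y)) (ccop C x)"
    by (subst sw_left_commute) (auto intro: h)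
  also have "\<dots> = sw (*) (\<lambda>x1 x2. sw (*) (\<lambda>a c. sw (*) (\<lambda>b d. h a b c d) (ccop C x2)) (ccop C x1)) (ccop C x)"
    by (rule sw_coassoc[symmetric]) (auto intro!: lin_sw_fun lin_sw_ccop bilinI h)
  finally show ?thesis .
qed

end

lemma adm_tpow_leftI:
  assumes "\<And>w. length w = n \<Longrightarrow> lin scm (\<lambda>m. f (m, w))" and "\<And>m. mlin sc n (\<lambda>w. f (m, w))"
  shows "adm (tpow_left scm sc {} {} n) f"
  unfolding adm_def tpow_left_def snd_conv ball_Un adm_slot_rels adm_bal_rels
  using assms by (auto simp: words_def mlin_iff_slots)

lemma length_iter_coact: "v \<in> Poly_Mapping.keys (iter_coact D n y) \<Longrightarrow> length (snd v) = n"
proof -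
  have "Poly_Mapping.keys (iter_coact D n y) \<subseteq> UNIV \<times> words n"
  proof (induction n)
    case (Suc n)
    then show ?case
      unfolding iter_coact.simps swr_def case_prod_beta
      by (intro keys_lext) (fastforce simp: words_def)
  qed (simp add: words_def)
  then show "v \<in> Poly_Mapping.keys (iter_coact D n y) \<Longrightarrow> length (snd v) = n"
    by (auto simp: words_def)
qed

section \<open>The coaction axioms and the iterated coaction\<close>

context right_comodule
begin

lemma lin_swr_dcoact:
  assumes "bilin (dsc D) (csc C) g"
  shows "lin (dsc D) (\<lambda>y. swr (*) g (dcoact D y))"
proof -
  have "adm (tpow_left (dsc D) (csc C) {} {} 1) (\<lambda>(d, w). g d (hd w))"
    using assms by (intro adm_tpow_leftI) (auto simp: bilin_def mlin_Suc)
  then show ?thesis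
    unfolding swr_def by (rule linear_into_lin[OF coact_linear])
qed

lemma swr_coassoc:
  assumes "\<And>b c. lin (dsc D) (\<lambda>a. h a b c)" "\<And>a c. lin (csc C) (\<lambda>b. h a b c)"
    "\<And>a b. lin (csc C) (\<lambda>c. h a b c)"
  shows "swr (*) (\<lambda>y x. swr (*) (\<lambda>y' x'. h y' x' x) (dcoact D y)) (dcoact D z) =
    swr (*) (\<lambda>y x. sw (*) (\<lambda>x' x''. h y x' x'') (ccop C x)) (dcoact D z)"
proof -
  have "adm (tpow_left (dsc D) (csc C) {} {} 2) (\<lambda>(d, w). h d (w ! 0) (w ! 1))"
    using assms by (intro adm_tpow_leftI) (auto simp: numeral_2_eq_2 mlin_Suc)
  from tens_rel_ev[OF coact_coassoc this] show ?thesis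
    by (simp add: ev_swr ev_sw)
qed

lemma swr_counit: "lin (dsc D) f \<Longrightarrow> swr (*) (\<lambda>y x. ccou C x * f y) (dcoact D z) = f z"
  using lin_swr[of "dsc D" f "\<lambda>y x. dsc D (ccou C x) y" "dcoact D z"]
  by (simp add: coact_counit lin_scale)

text \<open>One coaction suffices to produce all factors: a further coaction on \<open>y0\<close>
  equals, by coassociativity, a further coproduct on \<open>y1\<close>; for \<open>n = 0\<close> the
  counit removes \<open>y1\<close>.\<close>

lemma ev_iter_coact:
  assumes "\<And>w. length w = n \<Longrightarrow> lin (dsc D) (\<lambda>z. F (z, w))"
    and "\<And>z. mlin (csc C) n (\<lambda>w. F (z, w))"
  shows "ev F (iter_coact D n y) = swr (*) (\<lambda>y0 y1. ev (\<lambda>w. F (y0, w)) (iter_cc C n y1)) (dcoact D y)"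
  using assms
proof (induction n arbitrary: F)
  case 0
  then show ?case using swr_counit[of "\<lambda>z. F (z, [])"] by simp
next
  case (Suc n)
  \<comment> \<open>The transpose of the last coaction step, to which the induction hypothesis is
    applied.\<close>
  define F' where "F' = (\<lambda>(z, w). swr (*) (\<lambda>z' x. F (z', x # w)) (dcoact D z))"
  have "ev F (iter_coact D (Suc n) y) = ev F' (iter_coact D n y)"
    by (simp add: ev_lext ev_swr F'_def case_prod_beta')
  also have "\<dots> = swr (*) (\<lambda>y0 y1. ev (\<lambda>w. F' (y0, w)) (iter_cc C n y1)) (dcoact D y)"
  proof (rule Suc.IH)
    fix w :: "'c list" assume "length w = n"
    then show "lin (dsc D) (\<lambda>z. F' (z, w))"
      using Suc.prems by (auto simp: F'_def mlin_Suc intro!: lin_swr_dcoact bilinI)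
  next
    fix z
    show "mlin (csc C) n (\<lambda>w. F' (z, w))"
      using Suc.prems by (auto simp: F'_def mlin_Suc intro!: mlin_swr)
  qed
  also have "\<dots> = swr (*) (\<lambda>y0 y1. swr (*) (\<lambda>z x. ev (\<lambda>w. F (z, x # w)) (iter_cc C n y1)) (dcoact D y0)) (dcoact D y)"
    by (simp add: F'_def swr_ev_swap)
  also have "\<dots> = swr (*) (\<lambda>y0 y1. ev (\<lambda>w. F (y0, w)) (iter_cc C (Suc n) y1)) (dcoact D y)"
    unfolding ev_iter_cc_Suc using Suc.prems
    by (intro swr_coassoc) (auto simp: mlin_Suc intro!: lin_ev lin_iter_cc dest: length_iter_cc)
  finally show ?case .
qed

end

section \<open>Measurings\<close>

locale hopf_measuring = cocommutative_coalgebra C + H': left_bialgebroid H'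
  for C :: "('k::field, 'c::ab_group_add) coalgebra_data"
    and H :: "('k, 'u::{ring, monoid_mult}, 'a::{ring, monoid_mult}, 'z) hopf_algebroid_data_scheme"
    and H' :: "('k, 'u2::{ring, monoid_mult}, 'a2::{ring, monoid_mult}, 'z2) hopf_algebroid_data_scheme"
    and \<Psi> :: "'c \<Rightarrow> 'u \<Rightarrow> 'u2" and \<psi> :: "'c \<Rightarrow> 'a \<Rightarrow> 'a2" +
  assumes measuring: "hopf_algebroid_measuring C H H' \<Psi> \<psi>"
begin

lemma measuring_algebra: "algebra_measuring C (usc H) (usc H') \<Psi>" "algebra_measuring C (asc H) (asc H') \<psi>"
  using measuring by (simp_all add: hopf_algebroid_measuring_def)

lemma lin_Psi: "lin (usc H') f \<Longrightarrow> lin (usc H) (\<lambda>u. f (\<Psi> x u))"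
  and lin_Psi_left: "lin (usc H') f \<Longrightarrow> lin (csc C) (\<lambda>x. f (\<Psi> x u))"
  and lin_psi_left: "lin (asc H') f' \<Longrightarrow> lin (csc C) (\<lambda>x. f' (\<psi> x a))"
  using measuring_algebra by (auto simp: algebra_measuring_def linear_family_def intro: lin_compose)

lemma Psi_mult:
  assumes "lin (usc H') f"
  shows "f (\<Psi> x (u * v)) = sw (*) (\<lambda>x1 x2. f (\<Psi> x1 u * \<Psi> x2 v)) (ccop C x)"
  using measuring_algebra(1) lin_sw[OF assms] by (simp add: algebra_measuring_def)

lemma Psi_one: "lin (usc H') f \<Longrightarrow> f (\<Psi> x 1) = ccou C x * f 1"
  using measuring_algebra(1) by (simp add: algebra_measuring_def lin_scale)

lemma Psi_src: "\<Psi> x (src H a) = src H' (\<psi> x a)"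
  and Psi_tgt: "\<Psi> x (tgt H a) = tgt H' (\<psi> x a)"
  using measuring by (auto simp: hopf_algebroid_measuring_def Vmaps_def)

lemma sw_ucop_Psi:
  assumes "bal2 H' g"
  shows "sw (*) g (ucop H' (\<Psi> x u)) =
    sw (*) (\<lambda>x1 x2. sw (*) (\<lambda>u1 u2. g (\<Psi> x1 u1) (\<Psi> x2 u2)) (ucop H u)) (ccop C x)"
proof -
  have "ucop H' (\<Psi> x u) = cls (UA H' 2)
      (sw fscale (\<lambda>x1 x2. sw fscale (\<lambda>u1 u2. gen [\<Psi> x1 u1, \<Psi> x2 u2]) (ucop H u)) (ccop C x))"
    using measuring unfolding hopf_algebroid_measuring_def by blast
  from H'.sw_ucop_cls[OF this assms] show ?thesis by (simp add: ev_sw)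
qed

text \<open>In the paper's notation, \<open>pull x g\<close> is
  \<open>u\<^sup>1 \<otimes> \<dots> \<otimes> u\<^sup>n \<mapsto> g (x\<^sub>1(u\<^sup>1) \<otimes> \<dots> \<otimes> x\<^sub>n(u\<^sup>n))\<close>.\<close>

definition pull :: "'c \<Rightarrow> ('u2 list \<Rightarrow> 'k) \<Rightarrow> 'u list \<Rightarrow> 'k" where
  "pull x g w = ev (\<lambda>xs. g (map2 \<Psi> xs w)) (iter_cc C (length w) x)"

lemma pull_Nil: "pull x g [] = ccou C x * g []"
  by (simp add: pull_def)

lemma pull_Cons: "pull x g (u # w) = sw (*) (\<lambda>x1 x2. pull x2 (\<lambda>z. g (\<Psi> x1 u # z)) w) (ccop C x)"
  by (simp add: pull_def ev_iter_cc_Suc del: iter_cc.simps)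

lemma pull_cong:
  assumes "\<And>z. length z = length w \<Longrightarrow> g z = g' z"
  shows "pull x g w = pull x g' w"
  unfolding pull_def by (auto intro!: ev_cong assms dest: length_iter_cc)

lemma mlin_Psi:
  assumes "mlin (usc H') n g" "length w = n"
  shows "mlin (csc C) n (\<lambda>xs. g (map2 \<Psi> xs w))"
  using assms unfolding mlin_def by (auto simp: map2_update_left intro!: lin_Psi_left)

lemma lin_pull_left: "mlin (usc H') (length w) g \<Longrightarrow> lin (csc C) (\<lambda>x. pull x g w)"
  unfolding pull_def by (intro lin_iter_cc mlin_Psi) simp_all

lemma lin_pull:
  assumes "\<And>z. length z = length w \<Longrightarrow> lin sc (\<lambda>v. G v z)"
  shows "lin sc (\<lambda>v. pull x (G v) w)"
  unfolding pull_def by (auto intro!: lin_ev assms dest: length_iter_cc)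

lemma mlin_pull:
  assumes "\<And>z. length z = length w \<Longrightarrow> mlin sc n (\<lambda>v. G v z)"
  shows "mlin sc n (\<lambda>v. pull x (G v) w)"
  unfolding pull_def by (auto intro!: mlin_ev assms dest: length_iter_cc)

lemma bal_pull_fun:
  assumes "\<And>z. length z = length w \<Longrightarrow> bal K n (\<lambda>v. G v z)"
  shows "bal K n (\<lambda>v. pull x (G v) w)"
  unfolding pull_def by (auto intro!: bal_ev assms dest: length_iter_cc)

lemma pull_sw_swap: "pull x (\<lambda>z. sw (*) (\<lambda>a b. G a b z) X) w = sw (*) (\<lambda>a b. pull x (G a b) w) X"
  and pull_ev_swap: "pull x (\<lambda>z. ev (\<lambda>b. K b z) r) w = ev (\<lambda>b. pull x (K b) w) r"
  unfolding pull_def sw_ev_swap by (rule refl, rule ev_swap)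

lemma mlin_mult_right:
  assumes "mlin (usc H') n f" "length z = n"
  shows "mlin (usc H') n (\<lambda>w. f (map2 (*) w z))"
  using assms unfolding mlin_def by (auto simp: map2_update_left intro!: H'.lin_mult_right)

text \<open>On heads this is multiplicativity of \<open>\<Psi>\<close>, on tails it is induction.
  The four factors of \<open>x\<close> come out as two for the heads, then two for the tails, and
  \<open>sw_exchange\<close> regroups them by word.\<close>

lemma pull_mult:
  "mlin (usc H') n g \<Longrightarrow> length w = n \<Longrightarrow> length v = n \<Longrightarrow>
    pull x g (map2 (*) w v) =
    sw (*) (\<lambda>x1 x2. pull x1 (\<lambda>w'. pull x2 (\<lambda>v'. g (map2 (*) w' v')) v) w) (ccop C x)"
proof (induction n arbitrary: x g w v)
  case 0
  then show ?case
    using sw_counit_left[OF lin_pull_left[of "[]" g]] by (simp add: pull_Nil)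
next
  case (Suc n)
  then obtain a w' b v' where wv: "w = a # w'" "v = b # v'" and n: "length w' = n" "length v' = n"
    by (auto simp: length_Suc_conv)
  \<comment> \<open>The factors \<open>p, q\<close> act on the heads \<open>a, b\<close> and
    \<open>r, s\<close> on the tails \<open>w', v'\<close>.\<close>
  define h where "h p q r s =
    pull r (\<lambda>y. pull s (\<lambda>z. g (\<Psi> p a * \<Psi> q b # map2 (*) y z)) v') w'" for p q r s
  have lg: "lin (usc H') (\<lambda>c. g (c # z))" if "length z = n" for z
    using Suc.prems(1) that by (simp add: mlin_Suc)
  have mg: "mlin (usc H') n (\<lambda>z. g (c # z))" for c
    using Suc.prems(1) by (simp add: mlin_Suc)
  have h1: "lin (csc C) (\<lambda>p. h p q r s)" for q r s
    unfolding h_def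
    by (intro lin_pull lin_Psi_left[where f = "\<lambda>c. g (c * _ # _)"] H'.lin_mult_right lg) (simp add: n)
  have h2: "lin (csc C) (\<lambda>q. h p q r s)" for p r s
    unfolding h_def
    by (intro lin_pull lin_Psi_left[where f = "\<lambda>c. g (_ * c # _)"] H'.lin_mult_left lg) (simp add: n)
  have h3: "lin (csc C) (\<lambda>r. h p q r s)" for p q s
    unfolding h_def by (intro lin_pull_left mlin_pull mlin_mult_right) (simp_all add: n mg)
  have h4: "lin (csc C) (\<lambda>s. h p q r s)" for p q r
    unfolding h_def by (intro lin_pull lin_pull_left H'.mlin_mult_left) (simp_all add: n mg)
  have "pull x g (map2 (*) w v) =
      sw (*) (\<lambda>x1 x2. pull x2 (\<lambda>z. g (\<Psi> x1 (a * b) # z)) (map2 (*) w' v')) (ccop C x)"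
    by (simp add: wv pull_Cons)
  also have "\<dots> = sw (*) (\<lambda>x1 x2. sw (*) (\<lambda>p q. pull x2 (\<lambda>z. g (\<Psi> p a * \<Psi> q b # z)) (map2 (*) w' v'))
      (ccop C x1)) (ccop C x)"
  proof -
    have "lin (usc H') (\<lambda>c. pull x2 (\<lambda>z. g (c # z)) (map2 (*) w' v'))" for x2
      by (intro lin_pull lg) (simp add: n)
    from Psi_mult[OF this] show ?thesis by simp
  qed
  also have "\<dots> = sw (*) (\<lambda>x1 x2. sw (*) (\<lambda>p q. sw (*) (\<lambda>r s. h p q r s) (ccop C x2)) (ccop C x1)) (ccop C x)"
    by (simp add: Suc.IH[OF mg n] h_def)
  also have "\<dots> = sw (*) (\<lambda>x1 x2. sw (*) (\<lambda>p r. sw (*) (\<lambda>q s. h p q r s) (ccop C x2)) (ccop C x1)) (ccop C x)"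
    by (rule sw_exchange) (rule h1 h2 h3 h4)+
  also have "\<dots> = sw (*) (\<lambda>x1 x2. pull x1 (\<lambda>w'. pull x2 (\<lambda>v'. g (map2 (*) w' v')) v) w) (ccop C x)"
    by (simp only: wv pull_Cons) (simp add: h_def pull_sw_swap)
  finally show ?case .
qed

text \<open>Since \<open>\<Psi> x 1 = \<epsilon>(x) 1\<close>, the factor of \<open>x\<close> acting
  on the letter 1 disappears by the counit axiom.\<close>

lemma pull_one:
  assumes "mlin (usc H') (Suc (length z)) G"
  shows "pull x G (1 # z) = pull x (\<lambda>y. G (1 # y)) z"
proof -
  have "lin (usc H') (\<lambda>c. pull x2 (\<lambda>y. G (c # y)) z)" for x2
    using assms by (intro lin_pull) (simp add: mlin_Suc)
  from Psi_one[OF this]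
  have "pull x G (1 # z) = sw (*) (\<lambda>x1 x2. ccou C x1 * pull x2 (\<lambda>y. G (1 # y)) z) (ccop C x)"
    by (simp add: pull_Cons)
  also have "\<dots> = pull x (\<lambda>y. G (1 # y)) z"
    using assms by (intro sw_counit_left lin_pull_left) (simp add: mlin_Suc)
  finally show ?thesis .
qed

text \<open>On \<open>t(a) u \<otimes> v\<close> separate factors of \<open>x\<close> act on
  \<open>a\<close>, \<open>u\<close> and \<open>v\<close>. Cocommutativity moves the one on
  \<open>a\<close> past the one on \<open>u\<close>, and the balance of \<open>g\<close> applies
  since \<open>\<Psi>\<close> carries \<open>s\<close> and \<open>t\<close> to \<open>s'\<close> and
  \<open>t'\<close> through the same \<open>\<psi>\<close>.\<close>

lemma bal_pull: "bal H' n g \<Longrightarrow> bal H n (pull x g)"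
proof (induction n arbitrary: x g)
  case (Suc n)
  have lg: "lin (usc H') (\<lambda>c. g (c # z))" if "length z = n" for z
    using Suc.prems(1) that by (simp add: bal_Suc)
  have bg: "bal H' n (\<lambda>z. g (c # z))" for c
    using Suc.prems(1) by (simp add: bal_Suc)
  show ?case
    unfolding bal_Suc
  proof (intro conjI allI impI)
    fix w :: "'u list" assume "length w = n"
    then show "lin (usc H) (\<lambda>v. pull x g (v # w))"
      unfolding pull_Cons by (intro lin_sw_fun lin_pull lin_Psi lg) simp
  next
    fix u
    show "bal H n (\<lambda>w. pull x g (u # w))"
      unfolding pull_Cons by (intro bal_sw Suc.IH bg)
  next
    fix a u v and w :: "'u list" assume n: "Suc (length w) = n"
    have lg2: "lin (usc H') (\<lambda>c. g (b # c # z))" and tg: "g (tgt H' e * b # c # z) = g (b # src H' e * c # z)"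
      if "length z = length w" for b c e z
      using Suc.prems n that by (auto simp: bal_Suc)
    have mg2: "mlin (usc H') (length w) (\<lambda>z. g (b # c # z))" for b c
      using bal_mlin[OF Suc.prems(1)] n by (auto simp: mlin_Suc)
    \<comment> \<open>Here \<open>p\<close> acts on \<open>a\<close>, \<open>q\<close> on
      \<open>u\<close>, \<open>r\<close> on \<open>v\<close> and \<open>s\<close> on the rest;
      \<open>h'\<close> is the same function after using the balance of \<open>g\<close>.\<close>
    define h where "h p q r s = pull s (\<lambda>z. g (tgt H' (\<psi> p a) * \<Psi> q u # \<Psi> r v # z)) w" for p q r s
    have h': "h p q r s = pull s (\<lambda>z. g (\<Psi> q u # src H' (\<psi> p a) * \<Psi> r v # z)) w" for p q r s
      unfolding h_def by (rule pull_cong) (rule tg)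
    have h1: "lin (csc C) (\<lambda>p. h p q r s)" for q r s
      unfolding h_def
      by (intro lin_pull lin_psi_left[where f' = "\<lambda>c. g (tgt H' c * _ # _)"]
          lin_compose[OF H'.tgt_linear] H'.lin_mult_right lg) (simp add: n)
    have h2: "lin (csc C) (\<lambda>q. h p q r s)" for p r s
      unfolding h_def
      by (intro lin_pull lin_Psi_left[where f = "\<lambda>c. g (_ * c # _)"] H'.lin_mult_left lg) (simp add: n)
    have h3: "lin (csc C) (\<lambda>r. h p q r s)" for p q s
      unfolding h_def by (intro lin_pull lin_Psi_left lg2)
    have h4: "lin (csc C) (\<lambda>s. h p q r s)" for p q r
      unfolding h_def by (intro lin_pull_left mg2)
    have "pull x g (tgt H a * u # v # w) =
        sw (*) (\<lambda>x1 x2. sw (*) (\<lambda>p q. sw (*) (\<lambda>r s. h p q r s) (ccop C x2)) (ccop C x1)) (ccop C x)"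
    proof -
      have "lin (usc H') (\<lambda>c. sw (*) (\<lambda>r s. pull s (\<lambda>z. g (c # \<Psi> r v # z)) w) X)" for X
        by (intro lin_sw_fun lin_pull lg) (simp add: n)
      from Psi_mult[OF this] show ?thesis
        by (simp add: pull_Cons h_def Psi_tgt)
    qed
    also have "\<dots> = sw (*) (\<lambda>x1 x2. sw (*) (\<lambda>q p. sw (*) (\<lambda>r s. h p q r s) (ccop C x2)) (ccop C x1)) (ccop C x)"
      by (subst sw_commute) (auto intro!: bilinI lin_sw_fun h1 h2)
    also have "\<dots> = sw (*) (\<lambda>q y. sw (*) (\<lambda>p x2. sw (*) (\<lambda>r s. h p q r s) (ccop C x2)) (ccop C y)) (ccop C x)"
      by (rule sw_coassoc) (auto intro!: lin_sw_fun lin_sw_ccop bilinI h1 h2 h3 h4)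
    \<comment> \<open>The factors \<open>p, r\<close> are grouped under one coproduct, as
      multiplicativity on \<open>s(a) v\<close> requires.\<close>
    also have "\<dots> = sw (*) (\<lambda>q y. sw (*) (\<lambda>x2 s. sw (*) (\<lambda>p r. h p q r s) (ccop C x2)) (ccop C y)) (ccop C x)"
      by (subst sw_coassoc) (auto intro: h1 h3 h4)
    also have "\<dots> = pull x g (u # src H a * v # w)"
    proof -
      have "lin (usc H') (\<lambda>c. pull s (\<lambda>z. g (b # c # z)) w)" for s b
        by (intro lin_pull lg2)
      from Psi_mult[OF this] show ?thesis
        by (simp add: pull_Cons h' Psi_src)
    qed
    finally show "pull x g (tgt H a * u # v # w) = pull x g (u # src H a * v # w)" .
  qed
qed simp

text \<open>The factor of \<open>x\<close> acting on \<open>a\<close> arises next to the last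
  letter; cocommutativity moves it to the front, where coassociativity of the coaction of
  \<open>D\<close> can later attach it to \<open>y0\<close>.\<close>

lemma pull_tgt_last:
  "mlin (usc H') (Suc m) g \<Longrightarrow> length w = Suc m \<Longrightarrow>
    pull x g (w[m := tgt H a * w ! m]) =
    sw (*) (\<lambda>x1 x2. pull x2 (\<lambda>z. g (z[m := tgt H' (\<psi> x1 a) * z ! m])) w) (ccop C x)"
proof (induction m arbitrary: x g w)
  case 0
  then obtain u where w: "w = [u]" by (auto simp: length_Suc_conv)
  have l: "lin (usc H') (\<lambda>c. g [c])"
    using 0 by (simp add: mlin_Suc)
  have pull1: "pull x G [v] = G [\<Psi> x v]" if "lin (usc H') (\<lambda>c. G [c])" for x G v
    using sw_counit_right[OF lin_Psi_left[OF that]] by (simp add: pull_Cons pull_Nil)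
  show ?case
    using pull1[OF l] pull1[of "\<lambda>z. g (z[0 := _ * z ! 0])"] Psi_mult[OF l] H'.lin_mult_left[OF l]
    by (simp add: w Psi_tgt)
next
  case (Suc m)
  then obtain u w' where w: "w = u # w'" and m: "length w' = Suc m"
    by (auto simp: length_Suc_conv)
  have lg: "lin (usc H') (\<lambda>c. g (c # z))" if "length z = Suc m" for z
    using Suc.prems(1) that by (simp add: mlin_Suc[of _ "Suc m"])
  have mg: "mlin (usc H') (Suc m) (\<lambda>z. g (c # z))" for c
    using Suc.prems(1) by (simp add: mlin_Suc[of _ "Suc m"])
  \<comment> \<open>The factor \<open>p\<close> acts on the head, \<open>q\<close> on
    \<open>a\<close> and \<open>r\<close> on the tail.\<close>
  define h where "h p q r = pull r (\<lambda>z. g (\<Psi> p u # z[m := tgt H' (\<psi> q a) * z ! m])) w'" for p q r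
  have h1: "lin (csc C) (\<lambda>p. h p q r)" for q r
    unfolding h_def by (intro lin_pull lin_Psi_left lg) (simp add: m)
  have h2: "lin (csc C) (\<lambda>q. h p q r)" for p r
    unfolding h_def
    by (intro lin_pull lin_psi_left[where f' = "\<lambda>c. g (_ # _[m := tgt H' c * _])"]
          lin_compose[OF H'.tgt_linear] H'.lin_mult_right mlin_lin[OF mg]) (simp_all add: m)
  have h3: "lin (csc C) (\<lambda>r. h p q r)" for p q
  proof -
    have "mlin (usc H') (Suc m) (\<lambda>z. g (c # z[m := b * z ! m]))" for b c
      unfolding mlin_def
    proof (intro allI impI)
      fix z :: "'u2 list" and i assume z: "length z = Suc m" "i < Suc m"
      show "lin (usc H') (\<lambda>v. g (c # z[i := v, m := b * z[i := v] ! m]))"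
      proof (cases "i = m")
        case True
        then show ?thesis
          using z H'.lin_mult_left[OF mlin_lin[OF mg z], of c b] by simp
      next
        case False
        then show ?thesis
          using z mlin_lin[OF mg, of "z[m := b * z ! m]" i c] by (simp add: list_update_swap)
      qed
    qed
    then show ?thesis
      unfolding h_def by (intro lin_pull_left) (simp add: m)
  qed
  have "pull x g (w[Suc m := tgt H a * w ! Suc m]) =
      sw (*) (\<lambda>p y. sw (*) (\<lambda>q r. h p q r) (ccop C y)) (ccop C x)"
    by (simp add: w pull_Cons Suc.IH[OF mg m] h_def)
  also have "\<dots> = sw (*) (\<lambda>q y. sw (*) (\<lambda>p r. h p q r) (ccop C y)) (ccop C x)"
    by (rule sw_left_commute) (rule h1 h2 h3)+
  finally show ?case by (simp add: w pull_Cons h_def)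
qed

text \<open>A single coproduct is the compatibility of the measuring with \<open>\<Delta>\<close>.
  At each further one the factor of \<open>x\<close> on the first letter is itself split, and
  coassociativity of \<open>C\<close> lines the factors up again.\<close>

lemma ev_iter_cop_Psi:
  "bal H' (Suc m) g \<Longrightarrow> ev g (iter_cop H' m (\<Psi> x u)) = ev (pull x g) (iter_cop H m u)"
proof (induction m arbitrary: g)
  case 0
  then have "lin (usc H') (\<lambda>c. g [c])" by (simp add: bal_Suc)
  from sw_counit_right[OF lin_Psi_left[OF this]] show ?case
    by (simp add: pull_Cons pull_Nil)
next
  case (Suc m)
  have "pull x (split_head H' g) w = split_head H (pull x g) w" if "length w = Suc m" for w
  proof -
    obtain a w' where w: "w = a # w'" and m: "length w' = m"
      using \<open>length w = Suc m\<close> by (auto simp: length_Suc_conv)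
    \<comment> \<open>The factors \<open>p, q\<close> act on the two parts of the split head,
      \<open>r\<close> on the tail.\<close>
    define h where "h p q r =
      sw (*) (\<lambda>a1 a2. pull r (\<lambda>z. g (\<Psi> p a1 # \<Psi> q a2 # z)) w') (ucop H a)" for p q r
    have "pull x (split_head H' g) w =
        sw (*) (\<lambda>x1 r. pull r (\<lambda>z. sw (*) (\<lambda>v1 v2. g (v1 # v2 # z)) (ucop H' (\<Psi> x1 a))) w') (ccop C x)"
      by (simp add: w pull_Cons split_head_def)
    also have "\<dots> = sw (*) (\<lambda>x1 r. pull r (\<lambda>z. sw (*) (\<lambda>p q. sw (*) (\<lambda>a1 a2. g (\<Psi> p a1 # \<Psi> q a2 # z))
        (ucop H a)) (ccop C x1)) w') (ccop C x)"
    proof -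
      have "pull r (\<lambda>z. sw (*) (\<lambda>v1 v2. g (v1 # v2 # z)) (ucop H' (\<Psi> x1 a))) w' =
          pull r (\<lambda>z. sw (*) (\<lambda>p q. sw (*) (\<lambda>a1 a2. g (\<Psi> p a1 # \<Psi> q a2 # z)) (ucop H a)) (ccop C x1)) w'"
        for r x1
        by (rule pull_cong, rule sw_ucop_Psi, rule bal_bal2[OF Suc.prems]) (simp add: m)
      then show ?thesis by simp
    qed
    also have "\<dots> = sw (*) (\<lambda>x1 r. sw (*) (\<lambda>p q. h p q r) (ccop C x1)) (ccop C x)"
      by (simp add: pull_sw_swap h_def)
    also have "\<dots> = sw (*) (\<lambda>p y. sw (*) (\<lambda>q r. h p q r) (ccop C y)) (ccop C x)"
    proof (rule sw_coassoc)
      note g = bal_mlin[OF Suc.prems]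
      show "lin (csc C) (\<lambda>p. h p q r)" for q r
        unfolding h_def using g by (intro lin_sw_fun lin_pull lin_Psi_left) (simp add: mlin_Suc m)
      show "lin (csc C) (\<lambda>q. h p q r)" for p r
        unfolding h_def using g by (intro lin_sw_fun lin_pull lin_Psi_left) (simp add: mlin_Suc m)
      show "lin (csc C) (\<lambda>r. h p q r)" for p q
        unfolding h_def using g by (intro lin_sw_fun lin_pull_left) (simp add: mlin_Suc m)
    qed
    also have "\<dots> = split_head H (pull x g) w"
    proof -
      have "split_head H (pull x g) w = sw (*) (\<lambda>a1 a2. sw (*) (\<lambda>p y. sw (*) (\<lambda>q r.
          pull r (\<lambda>z. g (\<Psi> p a1 # \<Psi> q a2 # z)) w') (ccop C y)) (ccop C x)) (ucop H a)"
        by (simp add: w split_head_def pull_Cons)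
      also have "\<dots> = sw (*) (\<lambda>p y. sw (*) (\<lambda>a1 a2. sw (*) (\<lambda>q r.
          pull r (\<lambda>z. g (\<Psi> p a1 # \<Psi> q a2 # z)) w') (ccop C y)) (ucop H a)) (ccop C x)"
        by (rule sw_sw_swap)
      also have "\<dots> = sw (*) (\<lambda>p y. sw (*) (\<lambda>q r. h p q r) (ccop C y)) (ccop C x)"
        unfolding h_def by (subst sw_sw_swap) (rule refl)
      finally show ?thesis by simp
    qed
    finally show ?thesis .
  qed
  then show ?case
    unfolding ev_iter_cop_Suc Suc.IH[OF H'.bal_split_head[OF Suc.prems]]
    by (auto intro: ev_cong dest: length_iter_cop)
qed

text \<open>The induction rests on \<open>x(\<Delta>(u)(1 \<otimes> z)) = \<Delta>(x1 u)(1 \<otimes>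
  x2 z)\<close> for iterated coproducts, obtained from \<open>pull_mult\<close>,
  \<open>pull_one\<close> and \<open>ev_iter_cop_Psi\<close>.\<close>

lemma ev_xi_word_Psi:
  "bal H' (length us) g \<Longrightarrow>
    ev (pull x g) (xi_word H us) = pull x (\<lambda>z. ev g (xi_word H' z)) us"
proof (induction us arbitrary: x g)
  case Nil
  then show ?case by (simp add: pull_Nil)
next
  case (Cons u us)
  define m where "m = length us"
  have g: "bal H' (Suc m) g" using Cons.prems by (simp add: m_def)
  have "lmul H u (pull x g) z = sw (*) (\<lambda>x1 x2. pull x2 (lmul H' (\<Psi> x1 u) g) z) (ccop C x)"
    if z: "length z = m" for z
  proof -
    \<comment> \<open>The test function left for the coproduct of \<open>u\<close> once
      \<open>x2\<close> has acted on \<open>1 \<otimes> z\<close>.\<close>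
    define G where "G x2 w = pull x2 (\<lambda>z'. g (map2 (*) w (1 # z'))) z" for x2 w
    have G: "bal H' (Suc m) (G x2)" for x2
      unfolding G_def by (intro bal_pull_fun H'.bal_mult_right[OF g]) (simp add: z)
    have "pull x g (map2 (*) w (1 # z)) = sw (*) (\<lambda>x1 x2. pull x1 (G x2) w) (ccop C x)"
      if w: "length w = Suc m" for w
    proof -
      have "pull x2 (\<lambda>v'. g (map2 (*) w' v')) (1 # z) = G x2 w'" if "length w' = Suc m" for x2 w'
        unfolding G_def using H'.mlin_mult_left[OF bal_mlin[OF g] that] by (intro pull_one) (simp add: z)
      then show ?thesis
        using pull_mult[OF bal_mlin[OF g] w, of "1 # z" x] z w by (simp cong: pull_cong)
    qed
    then have "lmul H u (pull x g) z =
        ev (\<lambda>w. sw (*) (\<lambda>x1 x2. pull x1 (G x2) w) (ccop C x)) (iter_cop H m u)"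
      unfolding lmul_def z by (auto intro!: ev_cong dest: length_iter_cop)
    also have "\<dots> = sw (*) (\<lambda>x1 x2. ev (G x2) (iter_cop H' m (\<Psi> x1 u))) (ccop C x)"
      by (simp add: sw_ev_swap[symmetric] ev_iter_cop_Psi[OF G])
    also have "\<dots> = sw (*) (\<lambda>x1 x2. pull x2 (lmul H' (\<Psi> x1 u) g) z) (ccop C x)"
    proof -
      have "ev (G x2) (iter_cop H' m (\<Psi> x1 u)) = pull x2 (lmul H' (\<Psi> x1 u) g) z" for x1 x2
        unfolding G_def pull_ev_swap[symmetric] by (rule pull_cong) (simp add: lmul_def z)
      then show ?thesis by simp
    qed
    finally show ?thesis .
  qed
  then have "ev (pull x g) (xi_word H (u # us)) =
      ev (\<lambda>z. sw (*) (\<lambda>x1 x2. pull x2 (lmul H' (\<Psi> x1 u) g) z) (ccop C x)) (xi_word H us)"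
    unfolding ev_xi_word_Cons by (auto intro!: ev_cong dest: length_xi_word simp: m_def)
  also have "\<dots> = sw (*) (\<lambda>x1 x2. pull x2 (\<lambda>z. ev (lmul H' (\<Psi> x1 u) g) (xi_word H' z)) us) (ccop C x)"
    using Cons.IH[OF H'.bal_lmul] g by (simp add: sw_ev_swap[symmetric] m_def)
  also have "\<dots> = pull x (\<lambda>z. ev g (xi_word H' z)) (u # us)"
    by (simp add: pull_Cons ev_xi_word_Cons del: xi_word.simps)
  finally show ?case .
qed

end

section \<open>The comodule measuring and the commuting square\<close>

locale sayd_measuring = hopf_measuring C H H' \<Psi> \<psi> + right_comodule C D
    + P: sayd_module H P + P': sayd_module H' P'
  for C :: "('k::field, 'c::ab_group_add) coalgebra_data"
    and H :: "('k, 'u::{ring, monoid_mult}, 'a::{ring, monoid_mult}, 'z) hopf_algebroid_data_scheme"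
    and H' :: "('k, 'u2::{ring, monoid_mult}, 'a2::{ring, monoid_mult}, 'z2) hopf_algebroid_data_scheme"
    and \<Psi> :: "'c \<Rightarrow> 'u \<Rightarrow> 'u2" and \<psi> :: "'c \<Rightarrow> 'a \<Rightarrow> 'a2"
    and D :: "('k, 'c, 'd::ab_group_add) comodule_data"
    and P :: "('k, 'u, 'a, 'p::ab_group_add) sayd_data"
    and P' :: "('k, 'u2, 'a2, 'p2::ab_group_add) sayd_data" +
  fixes \<Omega> :: "'d \<Rightarrow> 'p \<Rightarrow> 'p2"
  assumes comodule_measuring: "comodule_measuring D P H' P' \<Psi> \<Omega>"
begin

lemma lin_Omega: "lin (psc P') f \<Longrightarrow> lin (psc P) (\<lambda>p. f (\<Omega> y p))"
  and lin_Omega_left: "lin (psc P') f \<Longrightarrow> lin (dsc D) (\<lambda>y. f (\<Omega> y p))"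
  using comodule_measuring
  by (auto simp: comodule_measuring_def linear_family_def intro: lin_compose)

text \<open>As \<open>p t(a) = a p\<close> in both modules, this is the compatibility of
  \<open>\<Omega>\<close> with the right action at \<open>u = t(a)\<close>, rewritten by
  \<open>\<Psi> t = t' \<psi>\<close>.\<close>

lemma Omega_lact:
  assumes "lin (psc P') f"
  shows "f (\<Omega> y (lact P a p)) = swr (*) (\<lambda>y0 y1. f (lact P' (\<psi> y1 a) (\<Omega> y0 p))) (dcoact D y)"
proof -
  have "\<Omega> y (ract P p (tgt H a)) =
      swr (psc P') (\<lambda>y0 y1. ract P' (\<Omega> y0 p) (\<Psi> y1 (tgt H a))) (dcoact D y)"
    using comodule_measuring by (simp add: comodule_measuring_def)
  then show ?thesis
    by (simp add: P.ract_tgt P'.ract_tgt Psi_tgt lin_swr[OF assms])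
qed

lemma ev_Omega_up:
  assumes "\<And>w. length w = n \<Longrightarrow> lin (psc P') (\<lambda>p. f (w, p))"
    and "\<And>p. mlin (usc H') n (\<lambda>w. f (w, p))" and "length w = n"
  shows "ev (\<lambda>(z, xs). f (map2 \<Psi> xs w, \<Omega> z p)) (iter_coact D n y) =
    swr (*) (\<lambda>y0 y1. pull y1 (\<lambda>v. f (v, \<Omega> y0 p)) w) (dcoact D y)"
proof -
  have "ev (\<lambda>(z, xs). f (map2 \<Psi> xs w, \<Omega> z p)) (iter_coact D n y) =
      swr (*) (\<lambda>y0 y1. ev (\<lambda>xs. case (y0, xs) of (z, xs) \<Rightarrow> f (map2 \<Psi> xs w, \<Omega> z p)) (iter_cc C n y1))
        (dcoact D y)"
    using assms by (intro ev_iter_coact) (auto intro!: lin_Omega_left mlin_Psi)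
  then show ?thesis by (simp add: pull_def assms(3))
qed

text \<open>This yields the well-definedness of the upper map. Inside the word the balance is
  \<open>bal_pull\<close>; with \<open>P\<close> it is \<open>pull_tgt_last\<close>, followed by
  coassociativity of the coaction and \<open>Omega_lact\<close>.\<close>

lemma adm_Omega_up:
  assumes f: "adm (Cup H' P' n) f"
  shows "adm (Cup H P n) (\<lambda>(us, p). ev (\<lambda>(z, xs). f (map2 \<Psi> xs us, \<Omega> z p)) (iter_coact D n y))"
proof -
  have b: "bal H' n (\<lambda>w. f (w, p))" for p using f by (simp add: adm_Cup_iff)
  have l: "lin (psc P') (\<lambda>p. f (w, p))" if "length w = n" for w
    using f that by (simp add: adm_Cup_iff)
  have up: "ev (\<lambda>(z, xs). f (map2 \<Psi> xs w, \<Omega> z p)) (iter_coact D n y) =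
      swr (*) (\<lambda>y0 y1. pull y1 (\<lambda>v. f (v, \<Omega> y0 p)) w) (dcoact D y)" if "length w = n" for w p
    by (rule ev_Omega_up[where f = f, OF l bal_mlin[OF b] that])
  show ?thesis
    unfolding adm_Cup_iff prod.case
  proof (intro conjI allI impI)
    fix p
    have "bal H n (\<lambda>w. swr (*) (\<lambda>y0 y1. pull y1 (\<lambda>v. f (v, \<Omega> y0 p)) w) (dcoact D y))"
      by (intro bal_swr bal_pull b)
    moreover have "bal H n (\<lambda>w. ev (\<lambda>(z, xs). f (map2 \<Psi> xs w, \<Omega> z p)) (iter_coact D n y)) \<longleftrightarrow>
        bal H n (\<lambda>w. swr (*) (\<lambda>y0 y1. pull y1 (\<lambda>v. f (v, \<Omega> y0 p)) w) (dcoact D y))"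
      by (rule bal_cong) (rule up)
    ultimately show "bal H n (\<lambda>w. ev (\<lambda>(z, xs). f (map2 \<Psi> xs w, \<Omega> z p)) (iter_coact D n y))"
      by simp
  next
    fix w :: "'u list" assume "length w = n"
    then show "lin (psc P) (\<lambda>p. ev (\<lambda>(z, xs). f (map2 \<Psi> xs w, \<Omega> z p)) (iter_coact D n y))"
      by (intro lin_ev) (auto intro!: lin_Omega l dest: length_iter_coact)
  next
    fix m a p and w :: "'u list" assume n: "n = Suc m" and w: "length w = n"
    have last: "f (z[m := tgt H' b * z ! m], q) = f (z, lact P' b q)" if "length z = n" for z b q
      using f n that by (simp add: adm_Cup_iff)
    have mf: "mlin (usc H') (Suc m) (\<lambda>v. f (v, q))" for q
      using bal_mlin[OF b] n by simp
    \<comment> \<open>The element \<open>d\<close> acts on \<open>p\<close>, \<open>b\<close> on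
      \<open>a\<close> and \<open>c\<close> on the word.\<close>
    define h where "h d b c = pull c (\<lambda>z. f (z, lact P' (\<psi> b a) (\<Omega> d p))) w" for d b c
    have h: "h d b c = pull c (\<lambda>z. f (z[m := tgt H' (\<psi> b a) * z ! m], \<Omega> d p)) w" for d b c
      unfolding h_def by (rule pull_cong) (simp add: last w)
    have "swr (*) (\<lambda>y0 y1. pull y1 (\<lambda>v. f (v, \<Omega> y0 p)) (w[m := tgt H a * w ! m])) (dcoact D y) =
        swr (*) (\<lambda>y0 y1. sw (*) (\<lambda>x1 x2. h y0 x1 x2) (ccop C y1)) (dcoact D y)"
      using w n by (simp add: pull_tgt_last[OF mf] h)
    \<comment> \<open>The first coproduct factor of \<open>y1\<close>, acting on \<open>a\<close>,
      becomes the \<open>C\<close>-part of a second coaction on \<open>y0\<close>.\<close>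
    also have "\<dots> = swr (*) (\<lambda>y0 y1. swr (*) (\<lambda>z0 z1. h z0 z1 y1) (dcoact D y0)) (dcoact D y)"
    proof (rule swr_coassoc[symmetric])
      show "lin (dsc D) (\<lambda>d. h d b c)" for b c
        unfolding h_def using lin_compose[OF P'.lact_linear(1) l]
        by (intro lin_pull lin_Omega_left[where f = "\<lambda>q. f (_, lact P' _ q)"]) (simp add: w)
      show "lin (csc C) (\<lambda>b. h d b c)" for d c
        unfolding h_def using lin_compose[OF P'.lact_linear(2) l]
        by (intro lin_pull lin_psi_left[where f' = "\<lambda>e. f (_, lact P' e _)"]) (simp add: w)
      show "lin (csc C) (\<lambda>c. h d b c)" for d b
        unfolding h_def using bal_mlin[OF b] by (intro lin_pull_left) (simp add: w)
    qed
    also have "\<dots> = swr (*) (\<lambda>y0 y1. pull y1 (\<lambda>v. f (v, \<Omega> y0 (lact P a p))) w) (dcoact D y)"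
    proof -
      have "swr (*) (\<lambda>z0 z1. h z0 z1 c) (dcoact D d) = pull c (\<lambda>v. f (v, \<Omega> d (lact P a p))) w" for c d
        unfolding h_def pull_def swr_ev_swap using w
        by (intro ev_cong Omega_lact[symmetric] l) (auto dest: length_iter_cc)
      then show ?thesis by simp
    qed
    finally show "ev (\<lambda>(z, xs). f (map2 \<Psi> xs (w[m := tgt H a * w ! m]), \<Omega> z p)) (iter_coact D n y) =
        ev (\<lambda>(z, xs). f (map2 \<Psi> xs w, \<Omega> z (lact P a p))) (iter_coact D n y)"
      using up w by simp
  qed
qed

text \<open>By \<open>ev_Omega_up\<close> both sides reduce to the action of \<open>y1\<close> on
  words, where \<open>ev_xi_word_Psi\<close> applies with \<open>\<Omega> y0 p\<close> carried along
  as a parameter.\<close>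

lemma ev_Omega_xi:
  assumes f: "adm (Cup H' P' n) f" and us: "length us = n"
  shows "ev (\<lambda>w. ev (\<lambda>(z, xs). f (map2 \<Psi> xs w, \<Omega> z p)) (iter_coact D n y)) (xi_word H us) =
    ev (\<lambda>(z, xs). ev (\<lambda>w. f (w, \<Omega> z p)) (xi_word H' (map2 \<Psi> xs us))) (iter_coact D n y)"
proof -
  have b: "bal H' n (\<lambda>w. f (w, p))" for p using f by (simp add: adm_Cup_iff)
  have l: "lin (psc P') (\<lambda>p. f (w, p))" if "length w = n" for w
    using f that by (simp add: adm_Cup_iff)
  have "ev (\<lambda>w. ev (\<lambda>(z, xs). f (map2 \<Psi> xs w, \<Omega> z p)) (iter_coact D n y)) (xi_word H us) =
      ev (\<lambda>w. swr (*) (\<lambda>y0 y1. pull y1 (\<lambda>v. f (v, \<Omega> y0 p)) w) (dcoact D y)) (xi_word H us)"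
    using us by (intro ev_cong ev_Omega_up[where f = f, OF l bal_mlin[OF b]]) (auto dest: length_xi_word)
  also have "\<dots> = swr (*) (\<lambda>y0 y1. pull y1 (\<lambda>z. ev (\<lambda>w. f (w, \<Omega> y0 p)) (xi_word H' z)) us) (dcoact D y)"
    using ev_xi_word_Psi[of us] b us by (simp add: swr_ev_swap[symmetric])
  also have "\<dots> = ev (\<lambda>(z, xs). ev (\<lambda>w. f (w, \<Omega> z p)) (xi_word H' (map2 \<Psi> xs us))) (iter_coact D n y)"
    by (rule ev_Omega_up[where f = "\<lambda>(v, q). ev (\<lambda>w. f (w, q)) (xi_word H' v)", unfolded prod.case, symmetric])
      (auto intro!: us lin_ev l H'.mlin_xi_word b dest: length_xi_word)
  finally show ?thesis .
qed

text \<open>Once the outer maps \<open>?up\<close> and \<open>?xi'\<close> are known to respect the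
  relations, both composites are unions of classes over the representatives in \<open>X\<close>; the
  classes agree for each representative, by testing with admissible functions.\<close>

lemma Omega_up_xi:
  assumes "X \<in> tens (Clow H P n)"
  shows "Omega_up D H' P' \<Psi> \<Omega> n y (xi H P n X) = xi H' P' n (Omega_low D H' P' \<Psi> \<Omega> n y X)"
proof -
  let ?up = "\<lambda>(us, p). lext fscale (\<lambda>(z, xs). gen (map2 \<Psi> xs us, \<Omega> z p)) (iter_coact D n y)"
  let ?low = "\<lambda>(p, us). lext fscale (\<lambda>(z, xs). gen (\<Omega> z p, map2 \<Psi> xs us)) (iter_coact D n y)"
  let ?xi = "\<lambda>(p, us). lext fscale (\<lambda>w. gen (w, p)) (xi_word H us)"
  let ?xi' = "\<lambda>(p, us). lext fscale (\<lambda>w. gen (w, p)) (xi_word H' us)"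
  have k: "Poly_Mapping.keys (?up v) \<subseteq> fst (Cup H' P' n)" if "v \<in> fst (Cup H P n)" for v
    using that by (cases v) (auto simp: Cup_def tpow_right_def words_def intro!: keys_lext dest!: length_iter_coact)
  have k_low: "Poly_Mapping.keys (?low v) \<subseteq> fst (Clow H' P' n)" if "v \<in> fst (Clow H P n)" for v
    using that by (cases v) (auto simp: Clow_def tpow_left_def words_def intro!: keys_lext dest!: length_iter_coact)
  have k_xi: "Poly_Mapping.keys (?xi v) \<subseteq> fst (Cup H P n)" if "v \<in> fst (Clow H P n)" for v
    using that by (cases v) (auto simp: Cup_def tpow_right_def Clow_def tpow_left_def words_def
        intro!: keys_lext dest!: length_xi_word)
  have k_xi': "Poly_Mapping.keys (?xi' v) \<subseteq> fst (Cup H' P' n)" if "v \<in> fst (Clow H' P' n)" for v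
    using that by (cases v) (auto simp: Cup_def tpow_right_def Clow_def tpow_left_def words_def
        intro!: keys_lext dest!: length_xi_word)
  have up: "(lext fscale ?up r, lext fscale ?up s) \<in> tens_rel (Cup H' P' n)"
    if "(r, s) \<in> tens_rel (Cup H P n)" for r s
    using k adm_Omega_up that
    by (intro lext_respects[where T = "Cup H P n"]) (simp_all add: case_prod_beta' ev_lext)
  have xi': "(lext fscale ?xi' r, lext fscale ?xi' s) \<in> tens_rel (Cup H' P' n)"
    if "(r, s) \<in> tens_rel (Clow H' P' n)" for r s
    using k_xi' P'.adm_xi that
    by (intro lext_respects[where T = "Clow H' P' n"]) (simp_all add: case_prod_beta' ev_lext)
  have keys: "Poly_Mapping.keys (lext fscale ?xi r) \<subseteq> fst (Cup H P n)"
      "Poly_Mapping.keys (lext fscale ?low r) \<subseteq> fst (Clow H' P' n)"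
    if "r \<in> X" for r
    using keys_in_tens[OF assms that]
    by (intro keys_lext k_xi, blast, intro keys_lext k_low, blast)
  have comm: "cls (Cup H' P' n) (lext fscale ?up (lext fscale ?xi r)) =
      cls (Cup H' P' n) (lext fscale ?xi' (lext fscale ?low r))" if r: "r \<in> X" for r
  proof (rule cls_eqI, unfold tens_rel_iff, intro conjI allI impI)
    show "Poly_Mapping.keys (lext fscale ?up (lext fscale ?xi r)) \<subseteq> fst (Cup H' P' n)"
      using keys(1)[OF r] by (intro keys_lext k) blast
    show "Poly_Mapping.keys (lext fscale ?xi' (lext fscale ?low r)) \<subseteq> fst (Cup H' P' n)"
      using keys(2)[OF r] by (intro keys_lext k_xi') blast
    fix f assume f: "adm (Cup H' P' n) f"
    have "length us = n" if "(p, us) \<in> Poly_Mapping.keys r" for p us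
      using keys_in_tens[OF assms r] that by (auto simp: Clow_def tpow_left_def words_def)
    then show "ev f (lext fscale ?up (lext fscale ?xi r)) = ev f (lext fscale ?xi' (lext fscale ?low r))"
      using ev_Omega_xi[OF f]
      by (auto simp: ev_lext case_prod_beta' intro!: ev_cong)
  qed
  have "Omega_up D H' P' \<Psi> \<Omega> n y (xi H P n X) =
      (\<Union>r\<in>X. cls (Cup H' P' n) (lext fscale ?up (lext fscale ?xi r)))"
    unfolding Omega_up_def xi_def by (rule lift_map_lift_map[OF up keys(1)])
  also have "\<dots> = (\<Union>r\<in>X. cls (Cup H' P' n) (lext fscale ?xi' (lext fscale ?low r)))"
    using comm by simp
  also have "\<dots> = xi H' P' n (Omega_low D H' P' \<Psi> \<Omega> n y X)"
    unfolding Omega_low_def xi_def by (rule lift_map_lift_map[OF xi' keys(2), symmetric])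
  finally show ?thesis .
qed

end

theorem theorem6p4:
  fixes H :: "('k::field, 'u::{ring, monoid_mult}, 'a::{ring, monoid_mult}) hopf_algebroid_data"
    and H' :: "('k, 'u2::{ring, monoid_mult}, 'a2::{ring, monoid_mult}) hopf_algebroid_data"
    and P :: "('k, 'u, 'a, 'p::ab_group_add) sayd_data"
    and P' :: "('k, 'u2, 'a2, 'p2::ab_group_add) sayd_data"
    and C :: "('k, 'c::ab_group_add) coalgebra_data"
    and D :: "('k, 'c, 'd::ab_group_add) comodule_data"
    and \<Psi> :: "'c \<Rightarrow> 'u \<Rightarrow> 'u2" and \<psi> :: "'c \<Rightarrow> 'a \<Rightarrow> 'a2"
    and \<Omega> :: "'d \<Rightarrow> 'p \<Rightarrow> 'p2"
    and y :: 'd and n :: nat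
  assumes "hopf_algebroid H" and "hopf_algebroid H'"
    and "sayd_module H P" and "sayd_module H' P'"
    and "cocommutative_coalgebra C"
    and "hopf_algebroid_measuring C H H' \<Psi> \<psi>"
    and "right_comodule C D"
    and "comodule_measuring D P H' P' \<Psi> \<Omega>"
  shows "\<forall>X\<in>tens (Clow H P n).
    (Omega_up D H' P' \<Psi> \<Omega> n y \<circ> xi H P n) X = (xi H' P' n \<circ> Omega_low D H' P' \<Psi> \<Omega> n y) X"
proof -
  interpret H': hopf_algebroid H' by fact
  have "left_bialgebroid H'" ..
  then interpret sayd_measuring C H H' \<Psi> \<psi> D P P' \<Omega>
    using assms by (intro sayd_measuring.intro hopf_measuring.intro hopf_measuring_axioms.intro
        sayd_measuring_axioms.intro)
  show ?thesis by (simp add: Omega_up_xi)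
qed

end
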